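(* Let $G$ be a finite group or a compact Lie group, let $\{U(g): g\in G\}$ be a unitary representation of $G$ on a Hilbert space $\mathcal{H}$, and let $|\psi\rangle,|\phi\rangle\in\mathcal{H}$ be unit vectors. Then $\psi$ and $\phi$ are unitarily $G$-equivalent if and only if $$\forall g\in G:\quad \chi_\psi(g)=\chi_\phi(g).$$
   Context: Unitary representations of compact Lie groups are (strongly) continuous; such a representation decomposes into a discrete set of finite-dimensional irreducible representations. Two pure states $\psi,\phi$ (unit vectors $|\psi\rangle,|\phi\rangle\in\mathcal{H}$) are called unitarily $G$-equivalent if there exists a unitary $V$ on $\mathcal{H}$ such that $[V,U(g)]=0$ for all $g\in G$ and $V|\psi\rangle=|\phi\rangle$. The characteristic function of a pure state $\psi$ relative to the representation $U$ is the function $\chi_\psi:G\to\mathbb{C}$, $\chi_\psi(g)=\langle\psi|U(g)|\psi\rangle$. *)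

theory Defs
  imports "HOL-Analysis.Analysis" "HOL-Algebra.Group"
begin

section \<open>Complex Hilbert spaces\<close>

text \<open>
  The underlying real Hilbert space (with inner product the real part of the complex one) is
  part of the class, so that norm, topology and completeness are those of the library.
  Following the Dirac convention, the complex inner product is linear in its second argument.
  The laws \<open>1 x = x\<close> and positive definiteness come from \<open>real_inner\<close>.
\<close>

class complex_hilbert_space = real_inner + complete_space +
  fixes scaleC :: "complex \<Rightarrow> 'a \<Rightarrow> 'a" (infixr "*\<^sub>C" 75)
    and cinner :: "'a \<Rightarrow> 'a \<Rightarrow> complex"
  assumes scaleC_add_right: "a *\<^sub>C (x + y) = a *\<^sub>C x + a *\<^sub>C y"
    and scaleC_add_left: "(a + b) *\<^sub>C x = a *\<^sub>C x + b *\<^sub>C x"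
    and scaleC_scaleC: "a *\<^sub>C b *\<^sub>C x = (a * b) *\<^sub>C x"
    and scaleC_of_real: "complex_of_real r *\<^sub>C x = r *\<^sub>R x"
    and cinner_commute: "cinner x y = cnj (cinner y x)"
    and cinner_add_right: "cinner x (y + z) = cinner x y + cinner x z"
    and cinner_scaleC_right: "cinner x (a *\<^sub>C y) = a * cinner x y"
    and Re_cinner: "Re (cinner x y) = inner x y"

definition unitary_op :: "('h::complex_hilbert_space \<Rightarrow> 'h) \<Rightarrow> bool" where
  "unitary_op V \<longleftrightarrow>
     (\<forall>x y. V (x + y) = V x + V y) \<and> (\<forall>a x. V (a *\<^sub>C x) = a *\<^sub>C V x) \<and>
     bij V \<and> (\<forall>x y. cinner (V x) (V y) = cinner x y)"


section \<open>Smooth manifolds and Lie groups\<close>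

text \<open>
  These notions are only meant for open \<open>S\<close>. Since the domain is finite-dimensional, the derivative
  is of class \<open>C\<^sup>k\<close> as an operator-valued function iff its value at every fixed vector \<open>v\<close> is.
\<close>

primrec Ck_on :: "nat \<Rightarrow> 'a::euclidean_space set \<Rightarrow> ('a \<Rightarrow> 'b::euclidean_space) \<Rightarrow> bool" where
  "Ck_on 0 S f \<longleftrightarrow> continuous_on S f"
| "Ck_on (Suc k) S f \<longleftrightarrow> (\<forall>x\<in>S. f differentiable (at x)) \<and>
     (\<forall>v. Ck_on k S (\<lambda>x. frechet_derivative f (at x) v))"

definition smooth_on :: "'a::euclidean_space set \<Rightarrow> ('a \<Rightarrow> 'b::euclidean_space) \<Rightarrow> bool" where
  "smooth_on S f \<longleftrightarrow> (\<forall>k. Ck_on k S f)"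

type_synonym ('g, 'e) chart = "'g set \<times> ('g \<Rightarrow> 'e)"

definition is_chart :: "'g topology \<Rightarrow> ('g, 'e::euclidean_space) chart \<Rightarrow> bool" where
  "is_chart T c \<longleftrightarrow> (case c of (D, \<phi>) \<Rightarrow> openin T D \<and> open (\<phi> ` D) \<and>
     homeomorphic_map (subtopology T D) (top_of_set (\<phi> ` D)) \<phi>)"

definition smooth_manifold :: "'g topology \<Rightarrow> ('g, 'e::euclidean_space) chart set \<Rightarrow> bool" where
  "smooth_manifold T A \<longleftrightarrow>
     Hausdorff_space T \<and> second_countable T \<and>
     (\<forall>c\<in>A. is_chart T c) \<and> \<Union> (fst ` A) = topspace T \<and>
     (\<forall>(D, \<phi>)\<in>A. \<forall>(D', \<phi>')\<in>A. smooth_on (\<phi> ` (D \<inter> D')) (\<phi>' \<circ> the_inv_into D \<phi>))"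

definition prod_atlas ::
    "('g, 'e) chart set \<Rightarrow> ('h, 'f) chart set \<Rightarrow> ('g \<times> 'h, 'e \<times> 'f) chart set" where
  "prod_atlas A B = {(D \<times> D', map_prod \<phi> \<phi>') |D \<phi> D' \<phi>'. (D, \<phi>) \<in> A \<and> (D', \<phi>') \<in> B}"

text \<open>Continuity makes the coordinate domains below open.\<close>

definition smooth_map ::
    "'g topology \<Rightarrow> ('g, 'e::euclidean_space) chart set \<Rightarrow>
     'h topology \<Rightarrow> ('h, 'f::euclidean_space) chart set \<Rightarrow> ('g \<Rightarrow> 'h) \<Rightarrow> bool" where
  "smooth_map T A T' A' f \<longleftrightarrow> continuous_map T T' f \<and>
     (\<forall>(D, \<phi>)\<in>A. \<forall>(D', \<phi>')\<in>A'.
        smooth_on (\<phi> ` (D \<inter> f -` D')) (\<phi>' \<circ> f \<circ> the_inv_into D \<phi>))"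

text \<open>
  All components of a Lie group have the same dimension, so a single model space suffices. As the
  types in \<open>euclidean_space\<close> have positive dimension, zero-dimensional Lie groups (the discrete
  groups) are not covered; the compact ones among these are the finite groups with the discrete
  topology.
\<close>

definition lie_group ::
    "('g, 'm) monoid_scheme \<Rightarrow> 'g topology \<Rightarrow> ('g, 'e::euclidean_space) chart set \<Rightarrow> bool" where
  "lie_group G T A \<longleftrightarrow>
     group G \<and> topspace T = carrier G \<and> smooth_manifold T A \<and>
     smooth_map (prod_topology T T) (prod_atlas A A) T A (\<lambda>(g, h). g \<otimes>\<^bsub>G\<^esub> h) \<and>
     smooth_map T A T A (\<lambda>g. inv\<^bsub>G\<^esub> g)"

definition compact_lie_group ::
    "('g, 'm) monoid_scheme \<Rightarrow> 'g topology \<Rightarrow> ('g, 'e::euclidean_space) chart set \<Rightarrow> bool" where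
  "compact_lie_group G T A \<longleftrightarrow> lie_group G T A \<and> compact_space T"

text \<open>With the discrete topology the continuity of a representation is no restriction.\<close>

definition finite_discrete_group :: "('g, 'm) monoid_scheme \<Rightarrow> 'g topology \<Rightarrow> bool" where
  "finite_discrete_group G T \<longleftrightarrow>
     group G \<and> finite (carrier G) \<and> T = discrete_topology (carrier G)"


section \<open>Unitary representations\<close>

definition unitary_representation ::
    "('g, 'm) monoid_scheme \<Rightarrow> 'g topology \<Rightarrow> ('g \<Rightarrow> 'h::complex_hilbert_space \<Rightarrow> 'h) \<Rightarrow> bool" where
  "unitary_representation G T U \<longleftrightarrow>
     (\<forall>g\<in>carrier G. unitary_op (U g)) \<and>
     (\<forall>g\<in>carrier G. \<forall>h\<in>carrier G. U (g \<otimes>\<^bsub>G\<^esub> h) = U g \<circ> U h) \<and>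
     (\<forall>x. continuous_map T euclidean (\<lambda>g. U g x))"

definition unitarily_equivalent ::
    "('g, 'm) monoid_scheme \<Rightarrow> ('g \<Rightarrow> 'h::complex_hilbert_space \<Rightarrow> 'h) \<Rightarrow> 'h \<Rightarrow> 'h \<Rightarrow> bool" where
  "unitarily_equivalent G U \<psi> \<phi> \<longleftrightarrow>
     (\<exists>V. unitary_op V \<and> (\<forall>g\<in>carrier G. V \<circ> U g = U g \<circ> V) \<and> V \<psi> = \<phi>)"

definition characteristic_function ::
    "('g \<Rightarrow> 'h::complex_hilbert_space \<Rightarrow> 'h) \<Rightarrow> 'h \<Rightarrow> 'g \<Rightarrow> complex" where
  "characteristic_function U \<psi> g = cinner \<psi> (U g \<psi>)"

end

theory Submission
  imports Defs
begin

text \<open>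
  If the characteristic functions agree, then \<open>U(g) \<psi> \<mapsto> U(g) \<phi>\<close> defines an isometric intertwiner
  between the cyclic subspaces of the two vectors, and the point is to extend it to all of \<open>H\<close>.
  This fails for noncompact groups (for a shift, a vector may be cyclic for a proper subspace), so
  compactness has to enter. It does so through the compactness of orbits only: minimising the
  Hilbert--Schmidt norm over the convex hull of the projections onto the vectors of an orbit gives
  a nonzero compact operator commuting with the group, without recourse to the Haar measure, and
  an eigenspace of its square is a finite-dimensional invariant subspace.

  By Zorn's lemma there is a maximal extension \<open>W : K \<rightarrow> L\<close> that is the identity on the complement of
  the invariant subspace generated by \<open>\<psi>\<close> and \<open>\<phi>\<close>. If \<open>K\<close> is proper, take a finite-dimensional
  invariant \<open>E\<close> orthogonal to \<open>K\<close>. By maximality, every copy of \<open>E\<close> orthogonal to that complement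
  is contained in \<open>L\<close>; hence \<open>E\<close>, \<open>W\<^sup>-\<^sup>1 E\<close>, \<open>W\<^sup>-\<^sup>2 E\<close>, \<dots> are infinitely many mutually orthogonal
  copies of \<open>E\<close>, whereas two vectors can generate only finitely many. The same applies to \<open>L\<close>.
\<close>

section \<open>Orthogonal projections\<close>

lemma Cauchy_mono_boundI:
  fixes u :: "nat \<Rightarrow> 'a::metric_space"
  assumes "\<And>n k. n \<le> k \<Longrightarrow> dist (u n) (u k) \<le> r n" and "r \<longlonglongrightarrow> 0"
  shows "Cauchy u"
proof (rule metric_CauchyI)
  fix e :: real assume "0 < e"
  then have "\<forall>\<^sub>F n in sequentially. r n < e / 2"
    using order_tendstoD(2)[OF assms(2), of "e / 2"] by simp
  then obtain N where "r N < e / 2"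
    by (auto simp: eventually_sequentially)
  then have "dist (u N) (u n) < e / 2" if "n \<ge> N" for n
    using assms(1)[OF that] by linarith
  then have "\<forall>m\<ge>N. \<forall>n\<ge>N. dist (u m) (u n) < e"
    by (meson dist_triangle_half_r)
  then show "\<exists>M. \<forall>m\<ge>M. \<forall>n\<ge>M. dist (u m) (u n) < e" by blast
qed

text \<open>The first-order condition at an extremum along a line. It yields orthogonality at a
  nearest point of a subspace, and the eigenvalue equation at a maximiser of
  \<open>norm (J x)\<close>.\<close>

lemma linear_coeff_zero_if_nonneg:
  fixes p q :: real
  assumes "\<And>t. 0 \<le> 2 * t * p + t\<^sup>2 * q"
  shows "p = 0"
proof (rule ccontr)
  assume p: "p \<noteq> 0"
  \<comment> \<open>The minimiser of the quadratic after \<open>q\<close> has been enlarged to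
    \<open>\<bar>q\<bar> + 1\<close>, which is positive even if \<open>q\<close> is not.\<close>
  define t where "t = - p / (\<bar>q\<bar> + 1)"
  have "0 \<le> 2 * t * p + t\<^sup>2 * (\<bar>q\<bar> + 1)"
    using assms[of t] mult_left_mono[of q "\<bar>q\<bar> + 1" "t\<^sup>2"] by fastforce
  also have "\<dots> = t * (2 * p + t * (\<bar>q\<bar> + 1))"
    by (simp add: power2_eq_square algebra_simps)
  also have "t * (\<bar>q\<bar> + 1) = - p"
    by (simp add: t_def add_nonneg_eq_0_iff)
  also have "t * (2 * p + - p) = - (p\<^sup>2 / (\<bar>q\<bar> + 1))"
    by (simp add: t_def power2_eq_square)
  finally have "p\<^sup>2 / (\<bar>q\<bar> + 1) \<le> 0" by simp
  moreover have "0 < p\<^sup>2 / (\<bar>q\<bar> + 1)"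
    using p by (intro divide_pos_pos) (auto intro: add_nonneg_pos)
  ultimately show False by simp
qed

text \<open>By the parallelogram law, a sequence minimising the distance to \<open>x\<close> is
  Cauchy; the first-order condition at its limit is orthogonality.\<close>

lemma orthogonal_projection_exists:
  fixes S :: "'a::{real_inner, complete_space} set"
  assumes S: "subspace S" "closed S"
  obtains p where "p \<in> S" "\<And>s. s \<in> S \<Longrightarrow> inner (x - p) s = 0"
proof -
  define m where "m = Inf ((\<lambda>s. (norm (x - s))\<^sup>2) ` S)"
  have bdd: "bdd_below ((\<lambda>s. (norm (x - s))\<^sup>2) ` S)"
    by (rule bdd_belowI[of _ 0]) auto
  have ne: "(\<lambda>s. (norm (x - s))\<^sup>2) ` S \<noteq> {}"
    using subspace_0[OF S(1)] by blast
  have m_le: "m \<le> (norm (x - s))\<^sup>2" if "s \<in> S" for s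
    unfolding m_def using bdd that by (auto intro: cInf_lower)
  have "\<exists>s\<in>S. (norm (x - s))\<^sup>2 < m + e" if "0 < e" for e
    using cInf_lessD[OF ne, of "m + e"] that by (auto simp: m_def)
  \<comment> \<open>The parallelogram law multiplies this tolerance by 4, so that the distances come
    out as at most \<open>1 / Suc n\<close>.\<close>
  then have "\<forall>n. \<exists>s\<in>S. (norm (x - s))\<^sup>2 < m + (1 / (2 * Suc n))\<^sup>2"
    by simp
  then obtain u where u: "\<And>n. u n \<in> S" "\<And>n. (norm (x - u n))\<^sup>2 < m + (1 / (2 * Suc n))\<^sup>2"
    by metis
  have dist_u: "dist (u n) (u k) \<le> 1 / Suc n" if "n \<le> k" for n k
  proof -
    have "(1/2) *\<^sub>R (u n + u k) \<in> S"
      using S(1) u(1) by (simp add: subspace_add subspace_scale)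
    then have "m \<le> (norm (x - (1/2) *\<^sub>R (u n + u k)))\<^sup>2"
      by (rule m_le)
    moreover have "(norm (u n - u k))\<^sup>2 = 2 * (norm (x - u n))\<^sup>2 + 2 * (norm (x - u k))\<^sup>2
       - 4 * (norm (x - (1/2) *\<^sub>R (u n + u k)))\<^sup>2"
      unfolding power2_norm_eq_inner
      by (simp add: inner_diff_left inner_diff_right inner_add_left inner_add_right inner_commute
          algebra_simps)
    moreover have "(1 / (2 * Suc k))\<^sup>2 \<le> (1 / (2 * Suc n))\<^sup>2"
      using that by (intro power_mono divide_left_mono) auto
    ultimately have "(norm (u n - u k))\<^sup>2 \<le> 4 * (1 / (2 * Suc n))\<^sup>2"
      using u(2)[of n] u(2)[of k] by linarith
    also have "\<dots> = (1 / Suc n)\<^sup>2"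
      by (simp only: power_divide power_mult_distrib of_nat_mult of_nat_numeral) simp
    finally show ?thesis
      unfolding dist_norm by (rule power2_le_imp_le) simp
  qed
  have "(\<lambda>n. 1 / real (Suc n)) \<longlonglongrightarrow> 0"
    using LIMSEQ_inverse_real_of_nat by (simp add: inverse_eq_divide)
  with dist_u have "Cauchy u" by (rule Cauchy_mono_boundI)
  then obtain p where p: "u \<longlonglongrightarrow> p"
    using Cauchy_convergent convergent_def by blast
  then have pS: "p \<in> S"
    using closed_sequentially[OF S(2)] u(1) by blast
  have "(norm (x - p))\<^sup>2 \<le> m"
  proof (rule LIMSEQ_le)
    show "(\<lambda>n. (norm (x - u n))\<^sup>2) \<longlonglongrightarrow> (norm (x - p))\<^sup>2"
      by (intro tendsto_intros p)
    have "(\<lambda>n. m + (1 / 2 * inverse (real (Suc n)))\<^sup>2) \<longlonglongrightarrow> m + (1 / 2 * 0)\<^sup>2"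
      by (intro tendsto_intros LIMSEQ_inverse_real_of_nat)
    then show "(\<lambda>n. m + (1 / (2 * Suc n))\<^sup>2) \<longlonglongrightarrow> m"
      by (simp add: inverse_eq_divide)
    show "\<exists>N. \<forall>n\<ge>N. (norm (x - u n))\<^sup>2 \<le> m + (1 / (2 * Suc n))\<^sup>2"
      using u(2) less_imp_le by blast
  qed
  have "inner (x - p) s = 0" if s: "s \<in> S" for s
  proof (rule linear_coeff_zero_if_nonneg)
    fix t :: real
    have "p - t *\<^sub>R s \<in> S"
      using S(1) pS s by (simp add: subspace_diff subspace_scale)
    then have "(norm (x - p))\<^sup>2 \<le> (norm (x - (p - t *\<^sub>R s)))\<^sup>2"
      using m_le \<open>_ \<le> m\<close> order_trans by blast
    then show "0 \<le> 2 * t * inner (x - p) s + t\<^sup>2 * inner s s"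
      unfolding power2_norm_eq_inner
      by (simp add: inner_diff_left inner_diff_right inner_add_left inner_add_right inner_commute
          algebra_simps power2_eq_square)
  qed
  with pS show thesis by (rule that)
qed

section \<open>Weighted sums of rank-one operators\<close>

text \<open>A self-adjoint finite-rank operator, represented by a list so that its Hilbert--Schmidt
  form can be computed from the entries, without traces or orthonormal bases.\<close>

definition rank_one_sum :: "(real \<times> 'a::real_inner) list \<Rightarrow> 'a \<Rightarrow> 'a" where
  "rank_one_sum l y = (\<Sum>(c, v)\<leftarrow>l. (c * inner v y) *\<^sub>R v)"

text \<open>The Hilbert--Schmidt inner product of the operators that the two lists represent.\<close>

definition hs_inner :: "(real \<times> 'a::real_inner) list \<Rightarrow> (real \<times> 'a) list \<Rightarrow> real" where
  "hs_inner l k = (\<Sum>(c, v)\<leftarrow>l. \<Sum>(d, w)\<leftarrow>k. c * d * (inner v w)\<^sup>2)"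

definition scale_weights :: "real \<Rightarrow> (real \<times> 'a) list \<Rightarrow> (real \<times> 'a) list" where
  "scale_weights r = map (apfst ((*) r))"

lemma rank_one_sum_simps [simp]:
  "rank_one_sum [] y = 0"
  "rank_one_sum ((c, v) # l) y = (c * inner v y) *\<^sub>R v + rank_one_sum l y"
  "rank_one_sum (l @ k) y = rank_one_sum l y + rank_one_sum k y"
  by (auto simp: rank_one_sum_def)

lemma rank_one_sum_scale [simp]: "rank_one_sum (scale_weights r l) y = r *\<^sub>R rank_one_sum l y"
  by (induction l) (auto simp: scale_weights_def scaleR_add_right)

lemma hs_inner_Nil [simp]: "hs_inner [] k = 0" "hs_inner l [] = 0"
  by (simp_all add: hs_inner_def case_prod_unfold sum_list_0)

lemma hs_inner_Cons_left:
  "hs_inner (p # l) k = hs_inner [p] k + hs_inner l k"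
  by (simp add: hs_inner_def)

lemma hs_inner_append_left [simp]: "hs_inner (l @ l') k = hs_inner l k + hs_inner l' k"
  by (simp add: hs_inner_def)

lemma hs_inner_append_right [simp]: "hs_inner l (k @ k') = hs_inner l k + hs_inner l k'"
  by (simp add: hs_inner_def case_prod_unfold sum_list_addf)

lemma hs_inner_Cons_right:
  "hs_inner l (q # k) = hs_inner l [q] + hs_inner l k"
  using hs_inner_append_right[of l "[q]" k] by simp

lemma hs_inner_single: "hs_inner [(c, v)] [(d, w)] = c * d * (inner v w)\<^sup>2"
  by (simp add: hs_inner_def)

text \<open>Reduces identities between biadditive forms on lists to single entries; symmetry of
  \<open>hs_inner\<close> and its block decomposition are both checked in this way.\<close>

lemma list_bilinear_eqI:
  fixes f g :: "'b list \<Rightarrow> 'b list \<Rightarrow> real"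
  assumes "\<And>k. f [] k = g [] k" "\<And>l. f l [] = g l []"
    and "\<And>x l k. f (x # l) k = f [x] k + f l k" "\<And>x l k. g (x # l) k = g [x] k + g l k"
    and "\<And>x l k. f l (x # k) = f l [x] + f l k" "\<And>x l k. g l (x # k) = g l [x] + g l k"
    and "\<And>x y. f [x] [y] = g [x] [y]"
  shows "f l k = g l k"
proof -
  have "f [x] k = g [x] k" for x k
    by (induction k) (simp add: assms(2), metis assms(5-7))
  then show ?thesis
    by (induction l) (simp add: assms(1), metis assms(3,4))
qed

lemma hs_inner_commute: "hs_inner l k = hs_inner k l"
proof (rule list_bilinear_eqI[where f = hs_inner and g = "\<lambda>l k. hs_inner k l"])
  show "hs_inner [p] [q] = hs_inner [q] [p]" for p q :: "real \<times> 'a"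
    by (cases p; cases q) (simp add: hs_inner_single inner_commute)
qed (simp, simp, rule hs_inner_Cons_left, rule hs_inner_Cons_right, rule hs_inner_Cons_right,
     rule hs_inner_Cons_left)

lemma hs_inner_scale_left [simp]: "hs_inner (scale_weights r l) k = r * hs_inner l k"
proof (induction l)
  case (Cons p l)
  obtain c v where p: "p = (c, v)" by (cases p)
  have "hs_inner [(r * c, v)] k = r * hs_inner [(c, v)] k"
    by (simp add: hs_inner_def case_prod_unfold sum_list_const_mult mult.assoc)
  then have "hs_inner (scale_weights r (p # l)) k = r * hs_inner [p] k + r * hs_inner l k"
    using Cons hs_inner_Cons_left[of "(r * c, v)" "scale_weights r l" k]
    by (simp add: scale_weights_def p)
  also have "\<dots> = r * hs_inner (p # l) k"
    by (subst hs_inner_Cons_left) (simp add: distrib_left)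
  finally show ?case .
qed (simp add: scale_weights_def)

lemma hs_inner_scale_right [simp]: "hs_inner l (scale_weights r k) = r * hs_inner l k"
  by (metis hs_inner_commute hs_inner_scale_left)

section \<open>Positivity of the Hilbert--Schmidt form and the bound it gives on the operator
  norm\<close>

definition project_away :: "'a::real_inner \<Rightarrow> 'a \<Rightarrow> 'a" where
  "project_away y v = v - inner v y *\<^sub>R y"

text \<open>The block decomposition with respect to the line of \<open>y\<close> and its complement:
  the diagonal entries at \<open>y\<close>, the off-diagonal column counted twice, and the
  compressions to the complement. On single entries it is the square of
  \<open>inner v w = inner v y * inner w y + inner v' w'\<close>, where primes denote the projected
  vectors.\<close>

lemma hs_inner_split:
  assumes y: "norm y = 1"
  shows "hs_inner l k = (\<Sum>(c, v)\<leftarrow>l. c * (inner v y)\<^sup>2) * (\<Sum>(c, v)\<leftarrow>k. c * (inner v y)\<^sup>2)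
    + 2 * inner (\<Sum>(c, v)\<leftarrow>l. (c * inner v y) *\<^sub>R project_away y v)
        (\<Sum>(c, v)\<leftarrow>k. (c * inner v y) *\<^sub>R project_away y v)
    + hs_inner (map (apsnd (project_away y)) l) (map (apsnd (project_away y)) k)"
proof (rule list_bilinear_eqI[where f = hs_inner and l = l and k = k], goal_cases)
  case (7 p q)
  obtain c v d w where pq: "p = (c, v)" "q = (d, w)" by (cases p, cases q)
  have yy: "inner y y = 1" using y by (simp add: norm_eq_1)
  have "inner v w = inner v y * inner w y + inner (project_away y v) (project_away y w)"
    using yy by (simp add: project_away_def inner_diff_left inner_diff_right inner_commute)
  then show ?case
    unfolding pq by (simp add: hs_inner_single power2_eq_square algebra_simps)
next
  case (4 p l k)
  show ?case
    by (subst list.map, subst hs_inner_Cons_left) (simp add: inner_add_left case_prod_unfold algebra_simps)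
next
  case (6 p l k)
  show ?case
    by (subst list.map(2)[of _ p k], subst hs_inner_Cons_right)
      (simp add: inner_add_right case_prod_unfold algebra_simps)
qed (simp_all, (rule hs_inner_Cons_left hs_inner_Cons_right)+)

text \<open>Schur's product theorem for the square of a Gram matrix: projecting away the direction of one
  of the vectors only decreases the form and kills that vector.\<close>

lemma hs_inner_nonneg: "0 \<le> hs_inner l l"
proof (induction l rule: length_induct)
  case (1 l)
  show ?case
  proof (cases l)
    case (Cons p l')
    obtain c v where p: "p = (c, v)" by (cases p)
    define y where "y = sgn v"
    define m where "m = map (apsnd (project_away y)) l'"
    have zero: "hs_inner ((c, 0) # k) ((c, 0) # k) = hs_inner k k" for k :: "(real \<times> 'a) list"
      by (simp add: hs_inner_def case_prod_unfold sum_list_0)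
    show ?thesis
    proof (cases "v = 0")
      case True
      with 1 zero show ?thesis by (simp add: Cons p)
    next
      case False
      then have y: "norm y = 1" by (simp add: y_def norm_sgn)
      have "project_away y v = 0"
        using False by (simp add: project_away_def y_def sgn_div_norm dot_square_norm power2_eq_square
          field_simps)
      then have "hs_inner (map (apsnd (project_away y)) l) (map (apsnd (project_away y)) l) = hs_inner m m"
        by (simp add: Cons p m_def zero)
      moreover have "0 \<le> hs_inner m m"
        using 1 by (simp add: Cons m_def)
      ultimately show ?thesis
        unfolding hs_inner_split[OF y, of l l] by simp
    qed
  qed simp
qed

text \<open>The operator norm is at most the Hilbert--Schmidt norm. For a unit vector
  \<open>y\<close>, the image of \<open>y\<close> has components \<open>\<alpha>\<close> along
  \<open>y\<close> and \<open>\<beta>\<close> orthogonal to it, and the block decomposition contains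
  \<open>\<alpha>\<close> squared once, the squared norm of \<open>\<beta>\<close> twice, and a
  nonnegative rest.\<close>

lemma norm_rank_one_sum_le: "(norm (rank_one_sum l y))\<^sup>2 \<le> hs_inner l l * (norm y)\<^sup>2"
proof -
  have unit: "(norm (rank_one_sum l y))\<^sup>2 \<le> hs_inner l l" if y: "norm y = 1" for y
  proof -
    define \<alpha> where "\<alpha> = (\<Sum>(c, v)\<leftarrow>l. c * (inner v y)\<^sup>2)"
    define \<beta> where "\<beta> = (\<Sum>(c, v)\<leftarrow>l. (c * inner v y) *\<^sub>R project_away y v)"
    have "inner y y = 1" using y by (simp add: norm_eq_1)
    then have "inner y (\<Sum>(c, v)\<leftarrow>l. (c * inner v y) *\<^sub>R project_away y v) = 0"
      by (induction l)
        (auto simp: inner_add_right project_away_def inner_diff_right inner_commute)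
    then have orth: "inner y \<beta> = 0" by (simp add: \<beta>_def)
    have "rank_one_sum l y = \<alpha> *\<^sub>R y + \<beta>"
      unfolding \<alpha>_def \<beta>_def
      by (induction l) (auto simp: project_away_def algebra_simps power2_eq_square)
    then have "(norm (rank_one_sum l y))\<^sup>2 = \<alpha> * \<alpha> + inner \<beta> \<beta>"
      using orth \<open>inner y y = 1\<close>
      by (simp add: power2_norm_eq_inner inner_add_left inner_add_right inner_commute)
    also have "\<dots> \<le> \<alpha> * \<alpha> + 2 * inner \<beta> \<beta> + 0" by simp
    also have "\<dots> \<le> hs_inner l l"
      unfolding hs_inner_split[OF y, of l l] \<alpha>_def \<beta>_def
      by (intro add_left_mono hs_inner_nonneg)
    finally show ?thesis .
  qed
  have lin: "rank_one_sum l (r *\<^sub>R z) = r *\<^sub>R rank_one_sum l z" for r and z :: 'a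
    by (induction l) (auto simp: algebra_simps)
  show ?thesis
  proof (cases "y = 0")
    case True
    then show ?thesis using lin[of 0 y] by simp
  next
    case False
    then have "(norm (rank_one_sum l (norm y *\<^sub>R sgn y)))\<^sup>2 \<le> hs_inner l l * (norm y)\<^sup>2"
      unfolding lin using mult_right_mono[OF unit[of "sgn y"], of "(norm y)\<^sup>2"]
      by (simp add: norm_sgn power_mult_distrib mult.commute)
    then show ?thesis
      using False by (simp add: sgn_div_norm)
  qed
qed

lemma linear_rank_one_sum: "linear (rank_one_sum l)"
proof (rule linearI)
  show "rank_one_sum l (x + y) = rank_one_sum l x + rank_one_sum l y" for x y
    by (induction l) (auto simp: algebra_simps inner_add_right)
  show "rank_one_sum l (r *\<^sub>R x) = r *\<^sub>R rank_one_sum l x" for r x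
    by (induction l) (auto simp: algebra_simps)
qed

lemma rank_one_sum_symmetric: "inner (rank_one_sum l x) y = inner x (rank_one_sum l y)"
  by (induction l) (auto simp: inner_add_left inner_add_right inner_commute)

lemma rank_one_sum_in_span: "rank_one_sum l y \<in> span (snd ` set l)"
  by (induction l) (auto intro!: span_add span_scale intro: span_base span_mono[THEN subsetD])

text \<open>On the unit ball every summand stays in a compact segment, and a sum of two compact sets
  is compact.\<close>

lemma rank_one_sum_in_compact:
  "\<exists>K. compact K \<and> (\<forall>y. norm y \<le> 1 \<longrightarrow> rank_one_sum l y \<in> K)"
proof (induction l)
  case Nil
  show ?case by (intro exI[of _ "{0}"]) simp
next
  case (Cons p l)
  then obtain K where K: "compact K" "\<And>y. norm y \<le> 1 \<Longrightarrow> rank_one_sum l y \<in> K" by blast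
  obtain c v where p: "p = (c, v)" by (cases p)
  let ?I = "(\<lambda>t. t *\<^sub>R v) ` cball 0 (\<bar>c\<bar> * norm v)"
  have "compact ?I"
    by (intro compact_continuous_image continuous_intros compact_cball)
  moreover have "rank_one_sum (p # l) y \<in> {x + y |x y. x \<in> ?I \<and> y \<in> K}" if "norm y \<le> 1" for y
  proof -
    have "\<bar>inner v y\<bar> \<le> norm v"
      using Cauchy_Schwarz_ineq2[of v y] mult_left_le[OF that, of "norm v"] by simp
    then have "c * inner v y \<in> cball 0 (\<bar>c\<bar> * norm v)"
      by (simp add: abs_mult mult_left_mono)
    then show ?thesis
      using K(2)[OF that] unfolding p rank_one_sum_simps by blast
  qed
  ultimately show ?case
    using compact_sums[OF _ K(1)] by blast
qed

section \<open>Spectral theory of limits of finite-rank operators\<close>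

text \<open>Norm limits of finite-rank operators are compact operators. A finite net for the
  finite-rank image also serves for the closure of the image under \<open>T\<close>, at the cost of
  three errors of size \<open>e / 4\<close>.\<close>

lemma compact_image_of_approximable:
  fixes T :: "'a::{real_inner, complete_space} \<Rightarrow> 'a"
  assumes "\<And>e. 0 < e \<Longrightarrow> \<exists>l. \<forall>y. norm (T y - rank_one_sum l y) \<le> e * norm y"
  shows "compact (closure (T ` cball 0 1))"
  unfolding compact_eq_totally_bounded
proof (intro conjI allI impI)
  show "complete (closure (T ` cball 0 1))"
    by (simp add: complete_eq_closed)
  fix e :: real assume e: "0 < e"
  then obtain l where l: "\<And>y. norm (T y - rank_one_sum l y) \<le> e / 4 * norm y"
    using assms[of "e / 4"] by auto
  obtain K where K: "compact K" "\<And>y. norm y \<le> 1 \<Longrightarrow> rank_one_sum l y \<in> K"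
    using rank_one_sum_in_compact by blast
  obtain k where k: "finite k" "K \<subseteq> (\<Union>x\<in>k. ball x (e / 4))"
    using compact_eq_totally_bounded[THEN iffD1, OF K(1)] e by (metis zero_less_divide_iff zero_less_numeral)
  have "z \<in> (\<Union>x\<in>k. ball x e)" if z: "z \<in> closure (T ` cball 0 1)" for z
  proof -
    obtain y where y: "norm y \<le> 1" "dist (T y) z < e / 4"
      using z e unfolding closure_approachable by (auto dest: spec[of _ "e / 4"])
    obtain x where x: "x \<in> k" "dist x (rank_one_sum l y) < e / 4"
      using k(2) K(2)[OF y(1)] by auto
    have "dist (T y) (rank_one_sum l y) \<le> e / 4"
      using order_trans[OF l[of y] mult_left_le[OF y(1), of "e / 4"]] e by (simp add: dist_norm)
    then have "dist x z < e"
      using x(2) y(2) dist_triangle[of x z "rank_one_sum l y"] dist_triangle[of "rank_one_sum l y" z "T y"]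
        dist_commute[of "T y" "rank_one_sum l y"] e by linarith
    then show ?thesis using x(1) by auto
  qed
  with k(1) show "\<exists>k. finite k \<and> closure (T ` cball 0 1) \<subseteq> (\<Union>x\<in>k. ball x e)"
    by blast
qed

text \<open>Passing to the square of the operator makes its norm an eigenvalue without any
  positivity assumption.\<close>

lemma square_has_finite_dim_eigenspace:
  fixes T :: "'a::{real_inner, complete_space} \<Rightarrow> 'a"
  assumes bl: "bounded_linear T" and sym: "\<And>y z. inner (T y) z = inner y (T z)"
    and nz: "T x \<noteq> 0"
    and approx: "\<And>e. 0 < e \<Longrightarrow> \<exists>l. \<forall>y. norm (T y - rank_one_sum l y) \<le> e * norm y"
  obtains \<mu> y where "\<mu> \<noteq> 0" "y \<noteq> 0" "T (T y) = \<mu> *\<^sub>R y"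
    "\<exists>B. finite B \<and> {y. T (T y) = \<mu> *\<^sub>R y} \<subseteq> span B"
    "compact ({y. T (T y) = \<mu> *\<^sub>R y} \<inter> cball 0 1)"
proof -
  define \<kappa> where "\<kappa> = onorm T"
  have pos: "0 < \<kappa>"
    using nz onorm_pos_lt[OF bl] by (auto simp: \<kappa>_def)
  have T_le: "norm (T y) \<le> \<kappa> * norm y" for y
    unfolding \<kappa>_def by (rule onorm[OF bl])
  note lin = bounded_linear.linear[OF bl]
  define C where "C = closure (T ` cball 0 1)"
  have C: "compact C"
    unfolding C_def using approx by (rule compact_image_of_approximable)
  have TC: "T y \<in> C" if "norm y \<le> 1" for y
    using that closure_subset by (force simp: C_def)
  let ?E = "{y. T (T y) = \<kappa>\<^sup>2 *\<^sub>R y}"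

  have "\<exists>y. norm y = 1 \<and> \<kappa> - \<kappa> / Suc n \<le> norm (T y)" for n
  proof -
    have "\<exists>x. (\<kappa> - \<kappa> / Suc n) * norm x < norm (T x)"
    proof (rule ccontr)
      assume "\<not> ?thesis"
      then have "onorm T \<le> \<kappa> - \<kappa> / Suc n"
        using pos by (intro onorm_bound) (auto simp: not_less divide_le_eq)
      then show False using pos by (simp add: \<kappa>_def[symmetric] divide_le_0_iff)
    qed
    then obtain x where x: "(\<kappa> - \<kappa> / Suc n) * norm x < norm (T x)" ..
    then have "x \<noteq> 0" using linear_0[OF lin] by auto
    then have "norm (T (sgn x)) = norm (T x) / norm x"
      by (simp add: sgn_div_norm linear_scale[OF lin] divide_inverse mult.commute)
    then have "\<kappa> - \<kappa> / Suc n \<le> norm (T (sgn x))"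
      using x \<open>x \<noteq> 0\<close> by (simp add: pos_le_divide_eq less_imp_le)
    then show ?thesis using \<open>x \<noteq> 0\<close> by (intro exI[of _ "sgn x"]) (simp add: norm_sgn)
  qed
  then obtain u where u: "\<And>n. norm (u n) = 1" "\<And>n. \<kappa> - \<kappa> / Suc n \<le> norm (T (u n))"
    by metis
  obtain z r where r: "strict_mono (r :: nat \<Rightarrow> nat)" "((\<lambda>n. T (u n)) \<circ> r) \<longlonglongrightarrow> z"
    using compact_imp_seq_compact[OF C] TC u(1) unfolding seq_compact_def by (metis order_refl)
  define v where "v = u \<circ> r"
  have Tv: "(\<lambda>n. T (v n)) \<longlonglongrightarrow> z"
    using r(2) by (simp add: v_def o_def)
  have "(\<lambda>n. norm (T (u n))) \<longlonglongrightarrow> \<kappa>"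
  proof (rule tendsto_sandwich[OF _ _ _ tendsto_const])
    have "(\<lambda>n. \<kappa> - \<kappa> * inverse (real (Suc n))) \<longlonglongrightarrow> \<kappa> - \<kappa> * 0"
      by (intro tendsto_intros LIMSEQ_inverse_real_of_nat)
    then show "(\<lambda>n. \<kappa> - \<kappa> / Suc n) \<longlonglongrightarrow> \<kappa>" by (simp add: divide_inverse)
    show "\<forall>\<^sub>F n in sequentially. \<kappa> - \<kappa> / Suc n \<le> norm (T (u n))"
      by (intro always_eventually allI u(2))
    show "\<forall>\<^sub>F n in sequentially. norm (T (u n)) \<le> \<kappa>"
      using T_le u(1) by (intro always_eventually allI) (metis mult.right_neutral)
  qed
  then have lim_norm: "(\<lambda>n. norm (T (v n))) \<longlonglongrightarrow> \<kappa>"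
    using LIMSEQ_subseq_LIMSEQ[OF _ r(1)] by (force simp: v_def o_def)
  \<comment> \<open>Unit vectors that nearly attain the norm of \<open>T\<close> are approximate
    eigenvectors of its square: when the norm is expanded, symmetry turns the mixed term into
    \<open>(norm (T (v n)))\<^sup>2\<close>, which tends to \<open>\<kappa>\<^sup>2\<close>.\<close>
  have diff0: "(\<lambda>n. T (T (v n)) - \<kappa>\<^sup>2 *\<^sub>R v n) \<longlonglongrightarrow> 0"
  proof -
    have "(norm (T (T (v n)) - \<kappa>\<^sup>2 *\<^sub>R v n))\<^sup>2 \<le> \<kappa>\<^sup>2 * (\<kappa>\<^sup>2 - (norm (T (v n)))\<^sup>2)" for n
    proof -
      have "norm (v n) = 1" using u(1) by (simp add: v_def)
      then have vv: "inner (v n) (v n) = 1" by (simp add: norm_eq_1)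
      have "(norm (T (T (v n))))\<^sup>2 \<le> (\<kappa> * norm (T (v n)))\<^sup>2"
        by (intro power_mono T_le) simp
      moreover have "(norm (T (T (v n)) - \<kappa>\<^sup>2 *\<^sub>R v n))\<^sup>2
          = (norm (T (T (v n))))\<^sup>2 - 2 * \<kappa>\<^sup>2 * (norm (T (v n)))\<^sup>2 + \<kappa>\<^sup>2 * \<kappa>\<^sup>2"
      proof -
        have ip: "inner (T (T (v n))) (v n) = (norm (T (v n)))\<^sup>2"
          unfolding sym[of "T (v n)" "v n"] by (simp add: power2_norm_eq_inner)
        have "(norm (a - r *\<^sub>R b))\<^sup>2 = (norm a)\<^sup>2 - 2 * r * inner a b + r * r * inner b b"
          for a b :: 'a and r
          unfolding power2_norm_eq_inner by (simp add: inner_diff_left inner_diff_right inner_commute)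
        from this[of "T (T (v n))" "\<kappa>\<^sup>2" "v n"] show ?thesis unfolding ip vv by simp
      qed
      ultimately show ?thesis by (simp add: power_mult_distrib algebra_simps)
    qed
    then have "norm (T (T (v n)) - \<kappa>\<^sup>2 *\<^sub>R v n) \<le> sqrt (\<kappa>\<^sup>2 * (\<kappa>\<^sup>2 - (norm (T (v n)))\<^sup>2))" for n
      by (rule real_le_rsqrt)
    then have "\<forall>\<^sub>F n in sequentially. norm (T (T (v n)) - \<kappa>\<^sup>2 *\<^sub>R v n)
        \<le> sqrt (\<kappa>\<^sup>2 * (\<kappa>\<^sup>2 - (norm (T (v n)))\<^sup>2))"
      by (rule always_eventually[OF allI])
    moreover have "(\<lambda>n. sqrt (\<kappa>\<^sup>2 * (\<kappa>\<^sup>2 - (norm (T (v n)))\<^sup>2))) \<longlonglongrightarrow> sqrt (\<kappa>\<^sup>2 * (\<kappa>\<^sup>2 - \<kappa>\<^sup>2))"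
      by (intro tendsto_intros lim_norm)
    then have "(\<lambda>n. sqrt (\<kappa>\<^sup>2 * (\<kappa>\<^sup>2 - (norm (T (v n)))\<^sup>2))) \<longlonglongrightarrow> 0" by simp
    ultimately show ?thesis by (rule Lim_null_comparison)
  qed
  have TTv: "(\<lambda>n. T (T (v n))) \<longlonglongrightarrow> T z"
    by (rule bounded_linear.tendsto[OF bl Tv])
  \<comment> \<open>Since \<open>T (T (v n))\<close> tends to \<open>T z\<close> and differs from
    \<open>\<kappa>\<^sup>2 *\<^sub>R v n\<close> by a null sequence, \<open>v\<close> itself
    converges, and this is its limit.\<close>
  define y where "y = (1 / \<kappa>\<^sup>2) *\<^sub>R T z"
  have "(\<lambda>n. (1 / \<kappa>\<^sup>2) *\<^sub>R (T (T (v n)) - (T (T (v n)) - \<kappa>\<^sup>2 *\<^sub>R v n))) \<longlonglongrightarrow> (1 / \<kappa>\<^sup>2) *\<^sub>R (T z - 0)"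
    by (intro tendsto_intros TTv diff0)
  then have vy: "v \<longlonglongrightarrow> y"
    using pos by (simp add: y_def)
  have "(\<lambda>n. norm (v n)) \<longlonglongrightarrow> norm y" by (intro tendsto_intros vy)
  then have "norm y = 1"
    using LIMSEQ_unique[OF tendsto_const[of 1]] u(1) by (force simp: v_def)
  then have y0: "y \<noteq> 0" by auto
  have "T (T y) = T z"
    using LIMSEQ_unique[OF TTv bounded_linear.tendsto[OF bl bounded_linear.tendsto[OF bl vy]]] ..
  then have eig: "T (T y) = \<kappa>\<^sup>2 *\<^sub>R y"
    using pos by (simp add: y_def)

  have sub: "subspace ?E"
    by (auto simp: subspace_def linear_0[OF lin] linear_add[OF lin] linear_scale[OF lin] scaleR_add_right)
  \<comment> \<open>On the eigenspace \<open>norm (T y)\<close> is at least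
    \<open>\<kappa> * norm y\<close>, so an approximation within \<open>\<kappa> / 2\<close> is
    injective there; its values lie in the span of finitely many vectors.\<close>
  have fin: "\<exists>B. finite B \<and> ?E \<subseteq> span B"
  proof -
    obtain l where l: "\<And>y. norm (T y - rank_one_sum l y) \<le> \<kappa> / 2 * norm y"
      using approx[of "\<kappa> / 2"] pos by auto
    have kernel: "y = 0" if y: "y \<in> ?E" "rank_one_sum l y = 0" for y
    proof -
      have "\<kappa> * (\<kappa> * norm y) = norm (T (T y))" using y(1) pos by (simp add: power2_eq_square)
      also have "\<dots> \<le> \<kappa> * norm (T y)" by (rule T_le)
      finally have "\<kappa> * norm y \<le> norm (T y)" using pos by simp
      also have "\<dots> \<le> \<kappa> / 2 * norm y" using l[of y] y(2) by simp
      finally have "norm y \<le> norm y / 2" using pos by simp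
      then show ?thesis by simp
    qed
    obtain B where B: "B \<subseteq> ?E" "independent B" "?E \<subseteq> span B"
      by (rule maximal_independent_subset)
    have spB: "span B \<subseteq> ?E" by (rule span_minimal[OF B(1) sub])
    have inj: "inj_on (rank_one_sum l) (span B)"
    proof (rule inj_onI)
      fix a b assume ab: "a \<in> span B" "b \<in> span B" "rank_one_sum l a = rank_one_sum l b"
      have "a - b \<in> ?E" using span_diff[OF ab(1,2)] spB by blast
      moreover have "rank_one_sum l (a - b) = 0"
        using ab(3) by (simp add: linear_diff[OF linear_rank_one_sum])
      ultimately have "a - b = 0" by (rule kernel)
      then show "a = b" by simp
    qed
    have "independent (rank_one_sum l ` B)"
      by (rule linear_independent_injective_image[OF linear_rank_one_sum B(2) inj])
    then have "finite (rank_one_sum l ` B)"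
      using independent_span_bound[of "snd ` set l" "rank_one_sum l ` B"]
      by (auto simp: rank_one_sum_in_span image_subset_iff)
    then have "finite B"
      by (rule finite_imageD[OF _ inj_on_subset[OF inj span_superset]])
    with B(3) show ?thesis by blast
  qed
  \<comment> \<open>On the eigenspace \<open>T\<close> divided by \<open>\<kappa>\<close> is a
    contraction and its own inverse, so the unit ball there is contained in a rescaled copy of the
    compact set \<open>C\<close>.\<close>
  have cpt: "compact (?E \<inter> cball 0 1)"
  proof -
    let ?C = "(\<lambda>z. (1 / \<kappa>) *\<^sub>R z) ` C"
    have "compact ?C"
      by (intro compact_continuous_image continuous_intros C)
    moreover have "?E \<inter> cball 0 1 \<subseteq> ?C"
    proof
      fix y assume y: "y \<in> ?E \<inter> cball 0 1"
      have "norm ((1 / \<kappa>) *\<^sub>R T y) \<le> 1"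
        using order_trans[OF T_le[of y] mult_left_le[of "norm y" \<kappa>]] y pos by simp
      moreover have "y = (1 / \<kappa>) *\<^sub>R T ((1 / \<kappa>) *\<^sub>R T y)"
        using y pos by (simp add: linear_scale[OF lin] power2_eq_square)
      ultimately show "y \<in> ?C" using TC by blast
    qed
    moreover have "closed ?E"
      by (intro closed_Collect_eq continuous_on_scaleR continuous_on_const continuous_on_id
          bounded_linear.continuous_on[OF bl])
    then have "closed (?E \<inter> cball 0 1)"
      by (rule closed_Int[OF _ closed_cball])
    ultimately show ?thesis
      using compact_Int_closed[of ?C "?E \<inter> cball 0 1"] by (simp add: Int_absorb1)
  qed
  show thesis
    using that[of "\<kappa>\<^sup>2" y] pos y0 eig fin cpt by simp
qed

section \<open>Groups of orthogonal operators with compact orbits\<close>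

text \<open>A set of operators takes the place of a represented group, so that unit scalars can be
  adjoined later. Strong continuity and compactness of the group supply the compact orbits.\<close>

locale orthogonal_group =
  fixes \<G> :: "('a::{real_inner, complete_space} \<Rightarrow> 'a) set"
  assumes id_mem: "id \<in> \<G>"
    and comp_mem: "\<And>g h. g \<in> \<G> \<Longrightarrow> h \<in> \<G> \<Longrightarrow> g \<circ> h \<in> \<G>"
    and inverse_mem: "\<And>g. g \<in> \<G> \<Longrightarrow> \<exists>h\<in>\<G>. (\<forall>x. h (g x) = x) \<and> (\<forall>x. g (h x) = x)"
    and linear_mem: "\<And>g. g \<in> \<G> \<Longrightarrow> linear g"
    and inner_mem: "\<And>g x y. g \<in> \<G> \<Longrightarrow> inner (g x) (g y) = inner x y"
    and compact_orbit: "\<And>x. compact ((\<lambda>g. g x) ` \<G>)"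
begin

definition invariant :: "'a set \<Rightarrow> bool" where
  "invariant S \<longleftrightarrow> (\<forall>g\<in>\<G>. \<forall>x\<in>S. g x \<in> S)"

lemma norm_mem: "g \<in> \<G> \<Longrightarrow> norm (g x) = norm x"
  by (simp add: norm_eq_sqrt_inner inner_mem)

lemma bounded_linear_mem: "g \<in> \<G> \<Longrightarrow> bounded_linear g"
  by (rule bounded_linear_intro[where K = 1])
    (auto simp: norm_mem linear_add linear_scale linear_mem)

text \<open>The inverse \<open>h\<close> of \<open>g\<close> is its adjoint.\<close>

lemma inner_mem_left:
  assumes "g \<in> \<G>"
  obtains h where "h \<in> \<G>" "\<And>x y. inner (g x) y = inner x (h y)" "\<And>x y. inner (h x) y = inner x (g y)"
    "\<And>x. h (g x) = x" "\<And>x. g (h x) = x"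
proof -
  obtain h where h: "h \<in> \<G>" "\<And>x. h (g x) = x" "\<And>x. g (h x) = x"
    using inverse_mem[OF assms] by blast
  have "inner (g x) y = inner x (h y)" "inner (h x) y = inner x (g y)" for x y
    using inner_mem[OF assms, of x "h y"] inner_mem[OF assms, of "h x" y] h by simp_all
  with h that show thesis by blast
qed

lemma invariant_orthogonal:
  assumes "invariant S"
  shows "invariant {x. \<forall>s\<in>S. inner x s = 0}"
  unfolding invariant_def
proof (intro ballI CollectI)
  fix g x s assume *: "g \<in> \<G>" "x \<in> {x. \<forall>s\<in>S. inner x s = 0}" "s \<in> S"
  obtain h where "h \<in> \<G>" "\<And>x y. inner (g x) y = inner x (h y)"
    using inner_mem_left[OF *(1)] by metis
  then show "inner (g x) s = 0"
    using * assms by (auto simp: invariant_def)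
qed

section \<open>An invariant operator from the convex hull of an orbit\<close>

definition orbit :: "'a \<Rightarrow> 'a set" where
  "orbit x = (\<lambda>g. g x) ` \<G>"

text \<open>Formal convex combinations of the rank-one operators of orbit vectors. Minimisation
  takes place over them, with \<open>hs_inner l l\<close> as the squared norm.\<close>

definition weight_lists :: "'a \<Rightarrow> (real \<times> 'a) list set" where
  "weight_lists x = {l. (\<forall>(c, v)\<in>set l. 0 \<le> c \<and> v \<in> orbit x) \<and> (\<Sum>(c, v)\<leftarrow>l. c) = 1}"

lemma weight_lists_midpoint:
  assumes "l \<in> weight_lists x" "k \<in> weight_lists x"
  shows "scale_weights (1/2) (l @ k) \<in> weight_lists x"
proof -
  have "(\<Sum>(c, v)\<leftarrow>scale_weights r l. c) = r * (\<Sum>(c, v)\<leftarrow>l. c)" for r and l :: "(real \<times> 'a) list"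
    by (induction l) (auto simp: scale_weights_def algebra_simps)
  then have "(\<Sum>(c, v)\<leftarrow>scale_weights (1/2) (l @ k). c) = 1"
    using assms by (simp add: weight_lists_def)
  moreover have "\<forall>(c, v)\<in>set (scale_weights (1/2) (l @ k)). 0 \<le> c \<and> v \<in> orbit x"
    using assms by (auto simp: weight_lists_def scale_weights_def)
  ultimately show ?thesis by (simp add: weight_lists_def)
qed

lemma weight_lists_translate:
  assumes "g \<in> \<G>" "l \<in> weight_lists x"
  shows "map (apsnd g) l \<in> weight_lists x"
proof -
  have "g v \<in> orbit x" if v: "v \<in> orbit x" for v
  proof -
    obtain h where "h \<in> \<G>" "v = h x" using v by (auto simp: orbit_def)
    then show ?thesis
      unfolding orbit_def using comp_mem[OF assms(1), of h] by (intro image_eqI[of _ _ "g \<circ> h"]) auto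
  qed
  moreover have "(\<Sum>(c, v)\<leftarrow>map (apsnd g) l. c) = (\<Sum>(c, v)\<leftarrow>l. c)"
    by (induction l) auto
  ultimately show ?thesis
    using assms(2) by (auto simp: weight_lists_def)
qed

lemma hs_inner_translate:
  assumes "g \<in> \<G>"
  shows "hs_inner (map (apsnd g) l) (map (apsnd g) k) = hs_inner l k"
  using assms by (simp add: hs_inner_def case_prod_unfold o_def inner_mem)

lemma rank_one_sum_translate:
  assumes "g \<in> \<G>"
  shows "rank_one_sum (map (apsnd g) l) (g y) = g (rank_one_sum l y)"
  using linear_mem[OF assms] by (induction l) (auto simp: inner_mem assms linear_0 linear_add linear_scale)

text \<open>\<open>L\<close> is a minimising sequence for the Hilbert--Schmidt norm over the convex hull of the rank-one
  operators of the orbit. By the parallelogram law it is a Cauchy sequence, and near-minimisers are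
  close to their translates, so that the limit is invariant.\<close>

lemma minimizing_weight_lists:
  obtains L where "\<And>n. L n \<in> weight_lists x"
    "\<And>n k y. n \<le> k \<Longrightarrow> norm (rank_one_sum (L n) y - rank_one_sum (L k) y) \<le> norm y / Suc n"
    "\<And>n g y. g \<in> \<G> \<Longrightarrow> norm (rank_one_sum (L n) (g y) - g (rank_one_sum (L n) y)) \<le> norm y / Suc n"
proof -
  let ?P = "weight_lists x" and ?Q = "\<lambda>l :: (real \<times> 'a) list. hs_inner l l"
  define m where "m = Inf (?Q ` ?P)"
  have bdd: "bdd_below (?Q ` ?P)"
    by (rule bdd_belowI[of _ 0]) (auto intro: hs_inner_nonneg)
  have "[(1, x)] \<in> ?P"
    using id_mem by (auto simp: weight_lists_def orbit_def intro: image_eqI[of _ _ id])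
  then have ne: "?Q ` ?P \<noteq> {}" by blast
  have "\<exists>l\<in>?P. ?Q l < m + e" if "0 < e" for e
    using cInf_lessD[OF ne, of "m + e"] that by (auto simp: m_def)
  then have "\<forall>n. \<exists>l\<in>?P. ?Q l < m + (1 / (2 * Suc n))\<^sup>2"
    by simp
  then obtain L where L: "\<And>n. L n \<in> ?P" "\<And>n. ?Q (L n) < m + (1 / (2 * Suc n))\<^sup>2"
    by metis
  have close: "norm (rank_one_sum l y - rank_one_sum k y) \<le> norm y / Suc n"
    if "l \<in> ?P" "k \<in> ?P" "?Q l \<le> m + (1 / (2 * Suc n))\<^sup>2" "?Q k \<le> m + (1 / (2 * Suc n))\<^sup>2" for l k n y
  proof -
    \<comment> \<open>This list represents the difference of the two operators. Its squared norm
      plus \<open>4 * q\<close> is twice the sum of the two squared norms, while \<open>q\<close> is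
      at least \<open>m\<close> because the midpoint is again admissible for the
      minimisation.\<close>
    let ?d = "l @ scale_weights (-1) k"
    define e where "e = (1 / real (2 * Suc n))\<^sup>2"
    define q where "q = ?Q (scale_weights (1/2) (l @ k))"
    have "m \<le> q"
      unfolding m_def q_def by (rule cInf_lower[OF imageI bdd]) (rule weight_lists_midpoint[OF that(1,2)])
    moreover have "4 * q = ?Q l + 2 * hs_inner l k + ?Q k"
      by (simp add: q_def hs_inner_commute[of k l] add_divide_distrib)
    moreover have d: "?Q ?d = ?Q l - 2 * hs_inner l k + ?Q k"
      by (simp add: hs_inner_commute[of k l])
    moreover have "?Q l \<le> m + e" "?Q k \<le> m + e"
      using that(3,4) by (simp_all only: e_def)
    ultimately have "?Q l - 2 * hs_inner l k + ?Q k \<le> 4 * e"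
      by linarith
    then have "?Q ?d \<le> 4 * (1 / (2 * Suc n))\<^sup>2"
      unfolding d e_def by simp
    also have "\<dots> = (1 / Suc n)\<^sup>2"
      by (simp only: power_divide power_mult_distrib of_nat_mult of_nat_numeral) simp
    finally have "?Q ?d * (norm y)\<^sup>2 \<le> (1 / Suc n)\<^sup>2 * (norm y)\<^sup>2"
      by (rule mult_right_mono) simp
    with norm_rank_one_sum_le have "(norm (rank_one_sum ?d y))\<^sup>2 \<le> (1 / Suc n)\<^sup>2 * (norm y)\<^sup>2"
      by (rule order_trans)
    also have "\<dots> = (norm y / Suc n)\<^sup>2"
      by (simp add: power_divide)
    finally have "norm (rank_one_sum ?d y) \<le> norm y / Suc n"
      by (rule power2_le_imp_le) simp
    then show ?thesis by simp
  qed
  show thesis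
  proof (rule that[OF L(1)])
    show "norm (rank_one_sum (L n) y - rank_one_sum (L k) y) \<le> norm y / Suc n" if "n \<le> k" for n k y
    proof (rule close[OF L(1) L(1)])
      have "(1 / (2 * Suc k))\<^sup>2 \<le> (1 / (2 * Suc n))\<^sup>2"
        using that by (intro power_mono divide_left_mono) auto
      then show "?Q (L n) \<le> m + (1 / (2 * Suc n))\<^sup>2" "?Q (L k) \<le> m + (1 / (2 * Suc n))\<^sup>2"
        using L(2)[of n] L(2)[of k] by linarith+
    qed
    show "norm (rank_one_sum (L n) (g y) - g (rank_one_sum (L n) y)) \<le> norm y / Suc n" if "g \<in> \<G>" for n g y
      using close[OF L(1) weight_lists_translate[OF that L(1)], of n n n "g y"] L(2)[of n]
      by (simp add: that hs_inner_translate rank_one_sum_translate norm_mem)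
  qed
qed

text \<open>Keeps the limit of the minimising sequence away from zero. Let \<open>W\<close> be a
  finite net of radius \<open>norm x\<close> in the orbit. All orbit vectors have the norm of
  \<open>x\<close>, so by polarisation each of them has inner product at least
  \<open>norm x ^ 2 / 2\<close> with some member of \<open>W\<close>. The resulting bound on
  rank-one operators is preserved by convex combinations.\<close>

lemma weight_lists_lower_bound:
  assumes "x \<noteq> 0"
  obtains W \<delta> where "finite W" "0 < \<delta>"
    "\<And>l. l \<in> weight_lists x \<Longrightarrow> \<delta> \<le> (\<Sum>w\<in>W. inner w (rank_one_sum l w))"
proof -
  obtain W where W: "finite W" "W \<subseteq> orbit x" "orbit x \<subseteq> (\<Union>w\<in>W. ball w (norm x))"
    using seq_compact_imp_totally_bounded[OF compact_imp_seq_compact[OF compact_orbit[of x]],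
        rule_format, of "norm x"] assms unfolding orbit_def by auto
  define \<delta> where "\<delta> = (norm x ^ 2 / 2)\<^sup>2"
  have orbit_norm: "norm v = norm x" if "v \<in> orbit x" for v
    using that by (auto simp: orbit_def norm_mem)
  have large: "\<delta> \<le> (\<Sum>w\<in>W. (inner w v)\<^sup>2)" if v: "v \<in> orbit x" for v
  proof -
    obtain w where w: "w \<in> W" "dist w v < norm x"
      using W(3) v by auto
    have "(norm (w - v))\<^sup>2 \<le> (norm x)\<^sup>2"
      using w(2) by (intro power_mono) (auto simp: dist_norm)
    then have "norm x ^ 2 / 2 \<le> inner w v"
      using orbit_norm[OF v] orbit_norm[of w] w(1) W(2) dot_norm_neg[of w v] by auto
    then have "\<delta> \<le> (inner w v)\<^sup>2"
      unfolding \<delta>_def by (intro power_mono) auto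
    also have "\<dots> \<le> (\<Sum>w\<in>W. (inner w v)\<^sup>2)"
      using w(1) W(1) by (intro member_le_sum) auto
    finally show ?thesis .
  qed
  show thesis
  proof (rule that[OF W(1)])
    show "0 < \<delta>" using assms by (simp add: \<delta>_def)
    fix l assume "l \<in> weight_lists x"
    then have l: "\<forall>(c, v)\<in>set l. 0 \<le> c \<and> v \<in> orbit x" "(\<Sum>(c, v)\<leftarrow>l. c) = 1"
      by (auto simp: weight_lists_def)
    have "(\<Sum>(c, v)\<leftarrow>l. c) * \<delta> \<le> (\<Sum>w\<in>W. inner w (rank_one_sum l w))"
      using l(1)
    proof (induction l)
      case (Cons p l)
      obtain c v where p: "p = (c, v)" by (cases p)
      have "c * \<delta> \<le> c * (\<Sum>w\<in>W. (inner w v)\<^sup>2)"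
        using Cons.prems large by (intro mult_left_mono) (auto simp: p)
      also have "\<dots> = (\<Sum>w\<in>W. inner w ((c * inner v w) *\<^sub>R v))"
        by (simp add: sum_distrib_left power2_eq_square inner_commute mult.assoc)
      finally show ?case
        using Cons by (simp add: p inner_add_right sum.distrib distrib_right)
    qed simp
    then show "\<delta> \<le> (\<Sum>w\<in>W. inner w (rank_one_sum l w))" using l(2) by simp
  qed
qed

text \<open>The pointwise limit of the minimising sequence. Symmetry and the range condition pass to
  the limit, the defect of commutation with \<open>g\<close> tends to zero, and the error is uniform
  on the unit ball, which gives approximation in operator norm.\<close>

lemma exists_invariant_operator:
  assumes M: "subspace M" "closed M" "invariant M" and x: "x \<in> M" "x \<noteq> 0"
  obtains T where "bounded_linear T" "\<And>y z. inner (T y) z = inner y (T z)"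
    "\<And>g y. g \<in> \<G> \<Longrightarrow> T (g y) = g (T y)" "\<And>y. T y \<in> M" "\<exists>y. T y \<noteq> 0"
    "\<And>e. 0 < e \<Longrightarrow> \<exists>l. \<forall>y. norm (T y - rank_one_sum l y) \<le> e * norm y"
proof -
  obtain L where L: "\<And>n. L n \<in> weight_lists x"
    "\<And>n k y. n \<le> k \<Longrightarrow> norm (rank_one_sum (L n) y - rank_one_sum (L k) y) \<le> norm y / Suc n"
    "\<And>n g y. g \<in> \<G> \<Longrightarrow> norm (rank_one_sum (L n) (g y) - g (rank_one_sum (L n) y)) \<le> norm y / Suc n"
    by (rule minimizing_weight_lists[of x]) blast
  let ?A = "\<lambda>n. rank_one_sum (L n)"
  have null: "(\<lambda>n. c / real (Suc n)) \<longlonglongrightarrow> 0" for c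
    using tendsto_mult[OF tendsto_const[of c] LIMSEQ_inverse_real_of_nat]
    by (simp add: divide_inverse)
  have "Cauchy (\<lambda>n. ?A n y)" for y
    using L(2) null by (intro Cauchy_mono_boundI[of _ "\<lambda>n. norm y / Suc n"]) (auto simp: dist_norm)
  then have "\<forall>y. \<exists>z. (\<lambda>n. ?A n y) \<longlonglongrightarrow> z"
    using Cauchy_convergent convergent_def by blast
  then obtain T where T: "\<And>y. (\<lambda>n. ?A n y) \<longlonglongrightarrow> T y"
    by metis
  have approx: "norm (T y - ?A n y) \<le> norm y / Suc n" for n y
  proof (rule LIMSEQ_le_const2)
    show "(\<lambda>k. norm (?A k y - ?A n y)) \<longlonglongrightarrow> norm (T y - ?A n y)"
      by (intro tendsto_intros T)
    show "\<exists>N. \<forall>k\<ge>N. norm (?A k y - ?A n y) \<le> norm y / Suc n"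
      using L(2) by (metis norm_minus_commute)
  qed
  note lin = linear_rank_one_sum
  have "T (y + z) = T y + T z" for y z
    using LIMSEQ_unique[OF T[of "y + z"]] tendsto_add[OF T[of y] T[of z]] by (simp add: linear_add[OF lin])
  moreover have "T (r *\<^sub>R y) = r *\<^sub>R T y" for r y
    using LIMSEQ_unique[OF T[of "r *\<^sub>R y"]] tendsto_scaleR[OF tendsto_const[of r] T[of y]]
    by (simp add: linear_scale[OF lin])
  moreover have "norm (T y) \<le> norm y * (1 + sqrt (hs_inner (L 0) (L 0)))" for y
  proof -
    have "norm (?A 0 y) \<le> sqrt (hs_inner (L 0) (L 0) * (norm y)\<^sup>2)"
      by (rule real_le_rsqrt) (rule norm_rank_one_sum_le)
    then have "norm (?A 0 y) \<le> norm y * sqrt (hs_inner (L 0) (L 0))"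
      by (simp add: real_sqrt_mult mult.commute)
    moreover have "norm (T y) \<le> norm (T y - ?A 0 y) + norm (?A 0 y)"
      using norm_triangle_ineq[of "T y - ?A 0 y" "?A 0 y"] by simp
    ultimately show ?thesis
      using approx[of y 0] by (simp add: distrib_left)
  qed
  ultimately have bl: "bounded_linear T"
    by (rule bounded_linear_intro)
  have sym: "inner (T y) z = inner y (T z)" for y z
    using LIMSEQ_unique[OF tendsto_inner[OF T[of y] tendsto_const[of z]]]
      tendsto_inner[OF tendsto_const[of y] T[of z]] by (simp add: rank_one_sum_symmetric)
  have comm: "T (g y) = g (T y)" if g: "g \<in> \<G>" for g y
  proof -
    have "(\<lambda>n. ?A n (g y) - g (?A n y)) \<longlonglongrightarrow> 0"
      by (rule Lim_null_comparison[OF always_eventually null[of "norm y"]]) (intro allI L(3) g)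
    moreover have "(\<lambda>n. ?A n (g y) - g (?A n y)) \<longlonglongrightarrow> T (g y) - g (T y)"
      by (intro tendsto_diff T bounded_linear.tendsto[OF bounded_linear_mem[OF g]])
    ultimately show ?thesis
      using LIMSEQ_unique by fastforce
  qed
  have inM: "T y \<in> M" for y
  proof (rule closed_sequentially[OF M(2) _ T])
    fix n
    have "snd ` set (L n) \<subseteq> M"
      using L(1)[of n] x(1) M(3) by (fastforce simp: weight_lists_def orbit_def invariant_def)
    then show "?A n y \<in> M"
      using rank_one_sum_in_span span_minimal[OF _ M(1)] by blast
  qed
  have nonzero: "\<exists>y. T y \<noteq> 0"
  proof (rule ccontr)
    assume "\<nexists>y. T y \<noteq> 0"
    then have null0: "(\<lambda>n. ?A n y) \<longlonglongrightarrow> 0" for y using T[of y] by simp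
    obtain W \<delta> where W: "finite W" "0 < \<delta>"
      "\<And>l. l \<in> weight_lists x \<Longrightarrow> \<delta> \<le> (\<Sum>w\<in>W. inner w (rank_one_sum l w))"
      by (rule weight_lists_lower_bound[OF x(2)]) blast
    have "(\<lambda>n. \<Sum>w\<in>W. inner w (?A n w)) \<longlonglongrightarrow> (\<Sum>w\<in>W. inner w 0)"
      by (intro tendsto_sum tendsto_inner tendsto_const null0)
    then have "\<delta> \<le> (\<Sum>w\<in>W. inner w 0)"
      using W(3) L(1) by (intro LIMSEQ_le_const) auto
    then show False using W(2) by simp
  qed
  have "\<exists>l. \<forall>y. norm (T y - rank_one_sum l y) \<le> e * norm y" if e: "0 < e" for e
  proof -
    obtain n where "inverse (real (Suc n)) < e"
      using reals_Archimedean[OF e] by blast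
    then have "norm y / Suc n \<le> e * norm y" for y
      using mult_right_mono[of "inverse (real (Suc n))" e "norm y"] by (simp add: divide_inverse mult.commute)
    then show ?thesis
      using approx order_trans by blast
  qed
  with bl sym comm inM nonzero show thesis by (rule that)
qed

text \<open>An eigenspace of \<open>T \<circ> T\<close> for a nonzero eigenvalue works: it is
  invariant because \<open>T\<close> commutes with the group, and it lies in the range of
  \<open>T\<close>, hence in \<open>M\<close>.\<close>

lemma exists_finite_dim_invariant_subspace:
  assumes M: "subspace M" "closed M" "invariant M" and x: "x \<in> M" "x \<noteq> 0"
  obtains E B where "E \<subseteq> M" "subspace E" "invariant E" "E \<noteq> {0}" "finite B" "E \<subseteq> span B"
    "compact (E \<inter> cball 0 1)"
proof -
  obtain T where T: "bounded_linear T" "\<And>y z. inner (T y) z = inner y (T z)"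
    "\<And>g y. g \<in> \<G> \<Longrightarrow> T (g y) = g (T y)" "\<And>y. T y \<in> M" "\<exists>y. T y \<noteq> 0"
    "\<And>e. 0 < e \<Longrightarrow> \<exists>l. \<forall>y. norm (T y - rank_one_sum l y) \<le> e * norm y"
    by (rule exists_invariant_operator[OF M x]) blast
  obtain x' where x': "T x' \<noteq> 0" using T(5) by blast
  obtain \<mu> y where \<mu>: "\<mu> \<noteq> 0" "y \<noteq> 0" "T (T y) = \<mu> *\<^sub>R y"
    "\<exists>B. finite B \<and> {y. T (T y) = \<mu> *\<^sub>R y} \<subseteq> span B"
    "compact ({y. T (T y) = \<mu> *\<^sub>R y} \<inter> cball 0 1)"
    by (rule square_has_finite_dim_eigenspace[OF T(1,2) x' T(6)]) blast
  note lin = bounded_linear.linear[OF T(1)]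
  show thesis
  proof (rule that[of "{y. T (T y) = \<mu> *\<^sub>R y}" "SOME B. finite B \<and> {y. T (T y) = \<mu> *\<^sub>R y} \<subseteq> span B"])
    show "{y. T (T y) = \<mu> *\<^sub>R y} \<subseteq> M"
    proof safe
      fix y assume "T (T y) = \<mu> *\<^sub>R y"
      then have "y = (1 / \<mu>) *\<^sub>R T (T y)" using \<mu>(1) by simp
      then show "y \<in> M" using subspace_scale[OF M(1) T(4)] by metis
    qed
    show "subspace {y. T (T y) = \<mu> *\<^sub>R y}"
      by (auto simp: subspace_def linear_0[OF lin] linear_add[OF lin] linear_scale[OF lin] scaleR_add_right)
    show "invariant {y. T (T y) = \<mu> *\<^sub>R y}"
      by (simp add: invariant_def T(3) linear_scale[OF linear_mem])
    show "{y. T (T y) = \<mu> *\<^sub>R y} \<noteq> {0}" using \<mu>(2,3) by blast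
  qed (insert someI_ex[OF \<mu>(4)] \<mu>(5), auto)
qed

end

section \<open>Extending isometric intertwiners\<close>

text \<open>Nontrivial solutions of finitely many linear conditions on finitely supported sequences.
  An additional condition is met by combining two solutions of the earlier ones; the bound
  \<open>N\<close> allows the second to be chosen beyond the support of the first.\<close>

lemma finitely_supported_annihilator:
  fixes F :: "(nat \<Rightarrow> real) set"
  assumes "finite F"
  shows "\<exists>a m. (\<exists>n\<ge>N. a n \<noteq> 0) \<and> (\<forall>n. n < N \<or> m \<le> n \<longrightarrow> a n = 0) \<and> (\<forall>f\<in>F. (\<Sum>n<m. a n * f n) = 0)"
  using assms
proof (induction F arbitrary: N rule: finite_induct)
  case empty
  show ?case
    by (intro exI[of _ "\<lambda>n. if n = N then 1 else 0"] exI[of _ "Suc N"]) auto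
next
  case (insert f F)
  obtain a m where a: "\<exists>n\<ge>N. a n \<noteq> 0" "\<And>n. n < N \<or> m \<le> n \<Longrightarrow> a n = 0"
    "\<And>f. f \<in> F \<Longrightarrow> (\<Sum>n<m. a n * f n) = 0"
    using insert.IH[of N] by blast
  \<comment> \<open>Starting at \<open>max N m\<close> makes the supports of \<open>a\<close> and
    \<open>b\<close> disjoint, so that their combination cannot vanish.\<close>
  obtain b k where b: "\<exists>n\<ge>max N m. b n \<noteq> 0" "\<And>n. n < max N m \<or> k \<le> n \<Longrightarrow> b n = 0"
    "\<And>f. f \<in> F \<Longrightarrow> (\<Sum>n<k. b n * f n) = 0"
    using insert.IH[of "max N m"] by blast
  have mk: "m \<le> k" using b(1,2) by (meson linorder_not_le max.boundedE order_trans less_imp_le)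
  have extend: "(\<Sum>n<k. a n * h n) = (\<Sum>n<m. a n * h n)" for h
    using mk a(2) by (intro sum.mono_neutral_right) auto
  define s t where "s = (\<Sum>n<k. a n * f n)" and "t = (\<Sum>n<k. b n * f n)"
  show ?case
  proof (cases "t = 0")
    case True
    then have "\<forall>h\<in>insert f F. (\<Sum>n<k. b n * h n) = 0"
      using b(3) by (simp add: t_def)
    moreover have "b n = 0" if "n < N \<or> k \<le> n" for n
      using that b(2)[of n] by (meson less_max_iff_disj)
    moreover have "\<exists>n\<ge>N. b n \<noteq> 0"
      using b(1) by auto
    ultimately show ?thesis by blast
  next
    case False
    \<comment> \<open>The coefficients make the two contributions to the condition \<open>f\<close>
      cancel; as \<open>t\<close> is nonzero, the part coming from \<open>a\<close>
      survives.\<close>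
    let ?c = "\<lambda>n. t * a n - s * b n"
    have sum_c: "(\<Sum>n<k. ?c n * h n) = t * (\<Sum>n<k. a n * h n) - s * (\<Sum>n<k. b n * h n)" for h
      by (simp add: sum_subtractf sum_distrib_left left_diff_distrib mult.assoc)
    obtain n where n: "N \<le> n" "a n \<noteq> 0" using a(1) by blast
    then have "n < m" using a(2) by (meson not_le)
    then have "?c n \<noteq> 0" using n False b(2)[of n] by simp
    moreover have "(\<Sum>i<k. ?c i * h i) = 0" if "h \<in> insert f F" for h
    proof (cases "h = f")
      case True
      then show ?thesis unfolding sum_c by (simp add: s_def[symmetric] t_def[symmetric])
    next
      case False
      then show ?thesis
        unfolding sum_c extend using that a(3) b(3) by simp
    qed
    moreover have "?c i = 0" if "i < N \<or> k \<le> i" for i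
    proof -
      have "a i = 0" "b i = 0" using that a(2)[of i] b(2)[of i] mk by (auto simp: less_max_iff_disj)
      then show ?thesis by simp
    qed
    ultimately show ?thesis
      using n(1) by (intro exI[of _ ?c] exI[of _ k]) blast
  qed
qed

lemma subspace_closure:
  fixes S :: "'a::real_normed_vector set"
  assumes "subspace S"
  shows "subspace (closure S)"
proof (rule subspaceI)
  show "0 \<in> closure S" using assms closure_subset subspace_0 by blast
  fix x y assume "x \<in> closure S" "y \<in> closure S"
  then obtain u v where "\<And>n. u n \<in> S" "u \<longlonglongrightarrow> x" "\<And>n. v n \<in> S" "v \<longlonglongrightarrow> y"
    unfolding closure_sequential by blast
  then show "x + y \<in> closure S"
    unfolding closure_sequential using assms
    by (intro exI[of _ "\<lambda>n. u n + v n"]) (auto intro: tendsto_add subspace_add)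
next
  fix x and c :: real assume "x \<in> closure S"
  then obtain u where "\<And>n. u n \<in> S" "u \<longlonglongrightarrow> x"
    unfolding closure_sequential by blast
  then show "c *\<^sub>R x \<in> closure S"
    unfolding closure_sequential using assms
    by (intro exI[of _ "\<lambda>n. c *\<^sub>R u n"]) (auto intro: tendsto_scaleR subspace_scale)
qed

lemma inner_eq_span:
  fixes S :: "('a::real_inner \<times> 'a) set"
  assumes "\<And>p q. p \<in> S \<Longrightarrow> q \<in> S \<Longrightarrow> inner (fst p) (fst q) = inner (snd p) (snd q)"
    and pq: "p \<in> span S" "q \<in> span S"
  shows "inner (fst p) (fst q) = inner (snd p) (snd q)"
proof -
  have base: "inner (fst p) (fst q) = inner (snd p) (snd q)" if "q \<in> S" for q
    using pq(1) by (induction rule: span_induct_alt) (auto simp: inner_add_left assms(1) that)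
  show ?thesis
    using pq(2) by (induction rule: span_induct_alt) (auto simp: inner_add_right base)
qed

context orthogonal_group
begin

text \<open>Linearity is demanded on \<open>E\<close> only, because the maps obtained below by
  iterated choice of preimages are uncontrolled elsewhere. Isometry is kept separate, since
  differences with projections are merely contractions.\<close>

definition intertwiner_on :: "'a set \<Rightarrow> ('a \<Rightarrow> 'a) \<Rightarrow> bool" where
  "intertwiner_on E J \<longleftrightarrow> (\<forall>x\<in>E. \<forall>y\<in>E. J (x + y) = J x + J y) \<and> (\<forall>c. \<forall>x\<in>E. J (c *\<^sub>R x) = c *\<^sub>R J x) \<and>
    (\<forall>g\<in>\<G>. \<forall>x\<in>E. J (g x) = g (J x))"

lemma intertwiner_onD:
  assumes "intertwiner_on E J" "x \<in> E"
  shows "y \<in> E \<Longrightarrow> J (x + y) = J x + J y" "J (c *\<^sub>R x) = c *\<^sub>R J x" "g \<in> \<G> \<Longrightarrow> J (g x) = g (J x)"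
  using assms by (auto simp: intertwiner_on_def)

lemma intertwiner_on_zero: "subspace E \<Longrightarrow> intertwiner_on E J \<Longrightarrow> J 0 = 0"
  using intertwiner_onD(2)[of E J 0 0] subspace_0 by auto

text \<open>Linearity and equivariance both follow from uniqueness of the point of \<open>L\<close>
  with residual orthogonal to \<open>L\<close>.\<close>

lemma invariant_projection_exists:
  assumes L: "subspace L" "closed L" "invariant L"
  obtains P where "\<And>x. P x \<in> L" "\<And>x s. s \<in> L \<Longrightarrow> inner (x - P x) s = 0"
    "intertwiner_on UNIV P"
proof -
  have "\<forall>x. \<exists>p\<in>L. \<forall>s\<in>L. inner (x - p) s = 0"
    using orthogonal_projection_exists[OF L(1,2)] by metis
  then obtain P where P: "\<And>x. P x \<in> L" "\<And>x s. s \<in> L \<Longrightarrow> inner (x - P x) s = 0"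
    by metis
  have unique: "P x = p" if "p \<in> L" "\<And>s. s \<in> L \<Longrightarrow> inner (x - p) s = 0" for x p
  proof -
    have d: "P x - p \<in> L" using P(1) that(1) L(1) by (simp add: subspace_diff)
    have "inner (P x - p) (P x - p) = inner (x - p) (P x - p) - inner (x - P x) (P x - p)"
      by (simp add: inner_diff_left)
    also have "\<dots> = 0" using P(2) that(2) d by simp
    finally show ?thesis by simp
  qed
  have "P (x + y) = P x + P y" for x y
  proof (rule unique)
    show "P x + P y \<in> L" using P(1) L(1) by (simp add: subspace_add)
    show "inner (x + y - (P x + P y)) s = 0" if "s \<in> L" for s
      using P(2)[OF that, of x] P(2)[OF that, of y] by (simp add: inner_diff_left inner_add_left)
  qed
  moreover have "P (c *\<^sub>R x) = c *\<^sub>R P x" for c x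
  proof (rule unique)
    show "c *\<^sub>R P x \<in> L" using P(1) L(1) by (simp add: subspace_scale)
    show "inner (c *\<^sub>R x - c *\<^sub>R P x) s = 0" if "s \<in> L" for s
      using P(2)[OF that, of x] by (simp add: inner_diff_left)
  qed
  moreover have "P (g x) = g (P x)" if g: "g \<in> \<G>" for g x
  proof (rule unique)
    show "g (P x) \<in> L" using P(1) L(3) g by (simp add: invariant_def)
    show "inner (g x - g (P x)) s = 0" if s: "s \<in> L" for s
    proof -
      obtain h where h: "h \<in> \<G>" "\<And>x y. inner (g x) y = inner x (h y)"
        by (rule inner_mem_left[OF g]) blast
      have "h s \<in> L" using h(1) s L(3) by (simp add: invariant_def)
      then have "inner (g (x - P x)) s = 0" unfolding h(2) by (rule P(2))
      then show ?thesis by (simp add: linear_diff[OF linear_mem[OF g]])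
    qed
  qed
  ultimately have "intertwiner_on UNIV P" by (simp add: intertwiner_on_def)
  with P that show thesis by blast
qed

text \<open>A version of Schur's lemma without irreducibility: on the eigenspace of the largest
  eigenvalue \<open>c\<close> of \<open>J\<^sup>* J\<close>, the map \<open>J / sqrt c\<close> is an isometry.\<close>

lemma intertwiner_top_eigenspace:
  assumes E: "subspace E" "invariant E" "compact (E \<inter> cball 0 1)"
    and J: "intertwiner_on E J" "\<And>x. x \<in> E \<Longrightarrow> norm (J x) \<le> norm x"
    and nz: "e \<in> E" "J e \<noteq> 0"
  obtains c E' where "0 < c" "E' \<subseteq> E" "subspace E'" "invariant E'" "E' \<noteq> {0}"
    "\<And>x y. x \<in> E' \<Longrightarrow> y \<in> E' \<Longrightarrow> inner (J x) (J y) = c * inner x y"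
proof -
  note JD = intertwiner_onD[OF J(1)]
  have diff: "J (x - y) = J x - J y" if "x \<in> E" "y \<in> E" for x y
    using JD(1)[of x "- y"] JD(2)[of y "-1"] that E(1) by (simp add: subspace_neg)
  have "continuous_on (E \<inter> cball 0 1) (\<lambda>x. norm (J x))"
  proof (rule continuous_on_norm, rule continuous_onI)
    fix x :: 'a and \<epsilon> :: real assume "x \<in> E \<inter> cball 0 1" "0 < \<epsilon>"
    moreover have "norm (J (y - x)) \<le> norm (y - x)" if "y \<in> E" "x \<in> E" for y
      using that E(1) by (intro J(2) subspace_diff)
    ultimately show "\<exists>d>0. \<forall>y\<in>E \<inter> cball 0 1. dist y x < d \<longrightarrow> dist (J y) (J x) \<le> \<epsilon>"
      by (intro exI[of _ \<epsilon>]) (fastforce simp: dist_norm diff[symmetric])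
  qed
  moreover have "E \<inter> cball 0 1 \<noteq> {}" using subspace_0[OF E(1)] by auto
  ultimately obtain u where u: "u \<in> E \<inter> cball 0 1" "\<And>x. x \<in> E \<inter> cball 0 1 \<Longrightarrow> norm (J x) \<le> norm (J u)"
    using continuous_attains_sup[OF E(3)] by blast
  define c where "c = (norm (J u))\<^sup>2"
  have bound: "inner (J x) (J x) \<le> c * inner x x" if x: "x \<in> E" for x
  proof (cases "x = 0")
    case True
    then show ?thesis using intertwiner_on_zero[OF E(1) J(1)] by simp
  next
    case False
    have "norm (J x) = norm x * norm (J (sgn x))"
      using JD(2)[OF x] False by (simp add: sgn_div_norm)
    also have "\<dots> \<le> norm x * norm (J u)"
      using x E(1) False by (intro mult_left_mono u(2)) (auto simp: sgn_div_norm subspace_scale)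
    finally have "(norm (J x))\<^sup>2 \<le> (norm x * norm (J u))\<^sup>2" by (intro power_mono) auto
    then show ?thesis by (simp add: c_def power2_norm_eq_inner power_mult_distrib mult.commute)
  qed
  have c: "0 < c"
  proof -
    have "0 < inner (J e) (J e)" using nz by simp
    also have "\<dots> \<le> c * inner e e" by (rule bound[OF nz(1)])
    finally show ?thesis by (simp add: c_def zero_less_mult_iff)
  qed
  \<comment> \<open>The equation says \<open>J\<^sup>* J x = c x\<close> in weak form, tested
    against vectors of \<open>E\<close>.\<close>
  define E' where "E' = {x \<in> E. \<forall>y\<in>E. inner (J x) (J y) = c * inner x y}"
  have uE: "u \<in> E" using u(1) by simp
  have u0: "u \<noteq> 0" using c intertwiner_on_zero[OF E(1) J(1)] by (auto simp: c_def)
  have uu: "inner (J u) (J u) = c * inner u u"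
  proof -
    have "inner u u \<le> 1" using u(1) by (simp add: norm_eq_sqrt_inner)
    then have "c * inner u u \<le> inner (J u) (J u)"
      using c mult_left_le[of "inner u u" c] by (simp add: c_def power2_norm_eq_inner)
    with bound[OF uE] show ?thesis by simp
  qed
  \<comment> \<open>By \<open>bound\<close> and \<open>uu\<close>, the defect
    \<open>c * inner v v - inner (J v) (J v)\<close> is nonnegative on \<open>E\<close> and zero at
    \<open>u\<close>; its first-order term in the direction \<open>y\<close> therefore
    vanishes.\<close>
  have "inner (J u) (J y) = c * inner u y" if y: "y \<in> E" for y
  proof -
    have "c * inner u y - inner (J u) (J y) = 0"
    proof (rule linear_coeff_zero_if_nonneg)
      fix t :: real
      have ty: "t *\<^sub>R y \<in> E" using y E(1) by (simp add: subspace_scale)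
      have "inner (J (u + t *\<^sub>R y)) (J (u + t *\<^sub>R y)) \<le> c * inner (u + t *\<^sub>R y) (u + t *\<^sub>R y)"
        using uE ty E(1) by (intro bound subspace_add)
      then show "0 \<le> 2 * t * (c * inner u y - inner (J u) (J y)) + t\<^sup>2 * (c * inner y y - inner (J y) (J y))"
        unfolding JD(1)[OF uE ty] JD(2)[OF y] using uu
        by (simp add: inner_add_left inner_add_right inner_commute algebra_simps power2_eq_square)
    qed
    then show ?thesis by simp
  qed
  then have "u \<in> E'" using uE by (simp add: E'_def)
  then have "E' \<noteq> {0}" using u0 by blast
  moreover have "subspace E'"
    unfolding subspace_def using E(1) intertwiner_on_zero[OF E(1) J(1)]
    by (auto simp: E'_def subspace_0 subspace_add subspace_scale JD inner_add_left distrib_left)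
  moreover have "invariant E'"
    unfolding invariant_def
  proof (intro ballI)
    fix g x assume g: "g \<in> \<G>" and x: "x \<in> E'"
    obtain h where h: "h \<in> \<G>" "\<And>x y. inner (g x) y = inner x (h y)"
      by (rule inner_mem_left[OF g]) blast
    have "inner (J (g x)) (J y) = c * inner (g x) y" if y: "y \<in> E" for y
    proof -
      have "h y \<in> E" using E(2) h(1) y by (simp add: invariant_def)
      then have "inner (J x) (J (h y)) = c * inner x (h y)" using x by (simp add: E'_def)
      then show ?thesis using x g by (simp add: E'_def JD(3)[OF _ g] JD(3)[OF y h(1)] h(2))
    qed
    then show "g x \<in> E'" using x g E(2) by (simp add: E'_def invariant_def)
  qed
  ultimately show thesis
    using c by (intro that[of c E']) (auto simp: E'_def)
qed

text \<open>Graphs of partial isometric intertwiners that fix \<open>Z\<close> pointwise.\<close>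

definition admissible :: "'a set \<Rightarrow> ('a \<times> 'a) set \<Rightarrow> bool" where
  "admissible Z \<Gamma> \<longleftrightarrow> subspace \<Gamma> \<and> (\<forall>g\<in>\<G>. \<forall>p\<in>\<Gamma>. map_prod g g p \<in> \<Gamma>) \<and>
    (\<forall>p\<in>\<Gamma>. \<forall>q\<in>\<Gamma>. inner (fst p) (fst q) = inner (snd p) (snd q)) \<and> (\<forall>z\<in>Z. (z, z) \<in> \<Gamma>)"

definition maximal_admissible :: "'a set \<Rightarrow> ('a \<times> 'a) set \<Rightarrow> bool" where
  "maximal_admissible Z \<Gamma> \<longleftrightarrow> admissible Z \<Gamma> \<and> (\<forall>\<Gamma>'. admissible Z \<Gamma>' \<longrightarrow> \<Gamma> \<subseteq> \<Gamma>' \<longrightarrow> \<Gamma>' = \<Gamma>)"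

section \<open>Inversion, closure and extension of admissible graphs\<close>

lemma linear_swap: "linear (prod.swap :: 'a \<times> 'a \<Rightarrow> 'a \<times> 'a)"
  by (rule linearI) auto

text \<open>Passing to the inverse. The conditions are symmetric in the two coordinates, so facts
  about domains become facts about ranges.\<close>

lemma admissible_swap:
  assumes "admissible Z \<Gamma>"
  shows "admissible Z (prod.swap ` \<Gamma>)"
  unfolding admissible_def
proof (intro conjI ballI)
  show "subspace (prod.swap ` \<Gamma>)"
    using assms by (intro linear_subspace_image[OF linear_swap]) (simp add: admissible_def)
  show "(z, z) \<in> prod.swap ` \<Gamma>" if "z \<in> Z" for z
    using assms that by (intro image_eqI[of _ _ "(z, z)"]) (auto simp: admissible_def)
  fix p assume p: "p \<in> prod.swap ` \<Gamma>"
  then show "map_prod g g p \<in> prod.swap ` \<Gamma>" if g: "g \<in> \<G>" for g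
    using assms g by (intro image_eqI[of _ _ "map_prod g g (prod.swap p)"]) (fastforce simp: admissible_def)+
  show "inner (fst p) (fst q) = inner (snd p) (snd q)" if "q \<in> prod.swap ` \<Gamma>" for q
    using assms that p unfolding admissible_def by (metis (no_types, lifting) fst_swap imageE snd_swap)
qed

lemma maximal_admissible_swap:
  assumes "maximal_admissible Z \<Gamma>"
  shows "maximal_admissible Z (prod.swap ` \<Gamma>)"
  unfolding maximal_admissible_def
proof (intro conjI allI impI)
  show "admissible Z (prod.swap ` \<Gamma>)"
    using assms by (simp add: maximal_admissible_def admissible_swap)
  fix \<Gamma>' assume *: "admissible Z \<Gamma>'" "prod.swap ` \<Gamma> \<subseteq> \<Gamma>'"
  have "\<Gamma> \<subseteq> prod.swap ` \<Gamma>'"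
    using image_mono[OF *(2), of prod.swap] by (simp add: image_image)
  then have "prod.swap ` \<Gamma>' = \<Gamma>"
    using assms admissible_swap[OF *(1)] by (simp add: maximal_admissible_def)
  then have "prod.swap ` prod.swap ` \<Gamma>' = prod.swap ` \<Gamma>" by simp
  then show "\<Gamma>' = prod.swap ` \<Gamma>" by (simp add: image_image)
qed

lemma admissible_norm:
  assumes "admissible Z \<Gamma>" "(x, y) \<in> \<Gamma>"
  shows "norm y = norm x"
  using assms unfolding admissible_def norm_eq_sqrt_inner by fastforce

lemma admissible_unique:
  assumes \<Gamma>: "admissible Z \<Gamma>" and "(x, y) \<in> \<Gamma>" "(x', y) \<in> \<Gamma>"
  shows "x = x'"
proof -
  have "(x, y) - (x', y) \<in> \<Gamma>"
    using assms by (intro subspace_diff) (auto simp: admissible_def)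
  then show ?thesis using admissible_norm[OF \<Gamma>, of "x - x'" 0] by simp
qed

lemma admissible_closure:
  assumes \<Gamma>: "admissible Z \<Gamma>"
  shows "admissible Z (closure \<Gamma>)"
  unfolding admissible_def
proof (intro conjI ballI)
  show "subspace (closure \<Gamma>)" using \<Gamma> by (simp add: admissible_def subspace_closure)
  show "(z, z) \<in> closure \<Gamma>" if "z \<in> Z" for z
    using that \<Gamma> closure_subset[of \<Gamma>] by (auto simp: admissible_def)
  fix p assume "p \<in> closure \<Gamma>"
  then obtain u where u: "\<And>n. u n \<in> \<Gamma>" "u \<longlonglongrightarrow> p" unfolding closure_sequential by blast
  show "map_prod g g p \<in> closure \<Gamma>" if g: "g \<in> \<G>" for g
  proof -
    note bl = bounded_linear.tendsto[OF bounded_linear_mem[OF g]]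
    have "(\<lambda>n. (g (fst (u n)), g (snd (u n)))) \<longlonglongrightarrow> (g (fst p), g (snd p))"
      by (intro tendsto_Pair bl tendsto_fst tendsto_snd u(2))
    moreover have "(g (fst (u n)), g (snd (u n))) \<in> \<Gamma>" for n
      using \<Gamma> g u(1)[of n] by (simp add: admissible_def map_prod_def case_prod_unfold)
    ultimately have "(g (fst p), g (snd p)) \<in> closure \<Gamma>"
      unfolding closure_sequential
      by (intro exI[of _ "\<lambda>n. (g (fst (u n)), g (snd (u n)))"]) simp
    then show ?thesis by (simp add: map_prod_def case_prod_unfold)
  qed
  fix q assume "q \<in> closure \<Gamma>"
  then obtain v where v: "\<And>n. v n \<in> \<Gamma>" "v \<longlonglongrightarrow> q" unfolding closure_sequential by blast
  have "(\<lambda>n. inner (fst (u n)) (fst (v n))) \<longlonglongrightarrow> inner (fst p) (fst q)"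
    by (intro tendsto_inner tendsto_fst u v)
  moreover have "(\<lambda>n. inner (fst (u n)) (fst (v n))) \<longlonglongrightarrow> inner (snd p) (snd q)"
  proof -
    have "inner (fst (u n)) (fst (v n)) = inner (snd (u n)) (snd (v n))" for n
      using \<Gamma> u(1) v(1) by (auto simp: admissible_def)
    moreover have "(\<lambda>n. inner (snd (u n)) (snd (v n))) \<longlonglongrightarrow> inner (snd p) (snd q)"
      by (intro tendsto_inner tendsto_snd u v)
    ultimately show ?thesis by simp
  qed
  ultimately show "inner (fst p) (fst q) = inner (snd p) (snd q)"
    by (rule LIMSEQ_unique)
qed

lemma admissible_domain:
  assumes "admissible Z \<Gamma>"
  shows "subspace (fst ` \<Gamma>)" "invariant (fst ` \<Gamma>)" "Z \<subseteq> fst ` \<Gamma>"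
proof -
  show "subspace (fst ` \<Gamma>)"
    using assms by (intro linear_subspace_image linear_fst) (simp add: admissible_def)
  show "invariant (fst ` \<Gamma>)"
    using assms unfolding admissible_def invariant_def by (metis (no_types, lifting) fst_map_prod imageE imageI)
  show "Z \<subseteq> fst ` \<Gamma>" using assms unfolding admissible_def by force
qed

text \<open>A maximal graph equals its closure. If points of the domain converge, their images form
  a Cauchy sequence by isometry, so the limiting pair is in the graph.\<close>

lemma maximal_admissible_closed_domain:
  assumes "maximal_admissible Z \<Gamma>"
  shows "closed (fst ` \<Gamma>)"
  unfolding closed_sequential_limits
proof (intro allI impI, elim conjE)
  have adm: "admissible Z \<Gamma>" using assms by (simp add: maximal_admissible_def)
  have "closure \<Gamma> = \<Gamma>"
    using assms admissible_closure[OF adm] closure_subset[of \<Gamma>] by (simp add: maximal_admissible_def)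
  then have cl: "closed \<Gamma>" by (metis closed_closure)
  fix x l assume x: "\<forall>n. x n \<in> fst ` \<Gamma>" "x \<longlonglongrightarrow> l"
  then have "\<forall>n. \<exists>y. (x n, y) \<in> \<Gamma>" by force
  then obtain y where y: "\<And>n. (x n, y n) \<in> \<Gamma>" by metis
  have "dist (y n) (y k) = dist (x n) (x k)" for n k
  proof -
    have "(x n, y n) - (x k, y k) \<in> \<Gamma>"
      using adm y by (intro subspace_diff) (auto simp: admissible_def)
    then show ?thesis using admissible_norm[OF adm] by (simp add: dist_norm)
  qed
  moreover have "Cauchy x" using x(2) by (rule LIMSEQ_imp_Cauchy)
  ultimately have "Cauchy y" by (simp add: Cauchy_def)
  then obtain m where "y \<longlonglongrightarrow> m" using Cauchy_convergent convergent_def by blast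
  then have "(\<lambda>n. (x n, y n)) \<longlonglongrightarrow> (l, m)" by (intro tendsto_Pair x(2))
  then have "(l, m) \<in> \<Gamma>" using closed_sequentially[OF cl, of "\<lambda>n. (x n, y n)"] y by simp
  then show "l \<in> fst ` \<Gamma>" by force
qed

text \<open>The orthogonal sum of the graph with that of \<open>J\<close>: mixed inner products
  vanish in both coordinates.\<close>

lemma admissible_extend:
  assumes \<Gamma>: "admissible Z \<Gamma>" and E: "subspace E" "invariant E" and J: "intertwiner_on E J"
    and iso: "\<And>x y. x \<in> E \<Longrightarrow> y \<in> E \<Longrightarrow> inner (J x) (J y) = inner x y"
    and orth: "\<And>x p. x \<in> E \<Longrightarrow> p \<in> \<Gamma> \<Longrightarrow> inner x (fst p) = 0 \<and> inner (J x) (snd p) = 0"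
  shows "admissible Z {p + q |p q. p \<in> \<Gamma> \<and> q \<in> (\<lambda>x. (x, J x)) ` E}" (is "admissible Z ?\<Gamma>'")
  unfolding admissible_def
proof (intro conjI ballI)
  note JD = intertwiner_onD[OF J]
  let ?D = "(\<lambda>x. (x, J x)) ` E"
  have "subspace ?D"
  proof (rule subspaceI)
    show "0 \<in> ?D"
      using subspace_0[OF E(1)] intertwiner_on_zero[OF E(1) J] by (intro image_eqI[of _ _ 0]) (auto simp: zero_prod_def)
    show "p + q \<in> ?D" if pq: "p \<in> ?D" "q \<in> ?D" for p q
    proof -
      obtain x y where "x \<in> E" "p = (x, J x)" "y \<in> E" "q = (y, J y)" using pq by auto
      then show ?thesis using E(1) by (intro image_eqI[of _ _ "x + y"]) (auto simp: JD subspace_add)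
    qed
    show "c *\<^sub>R p \<in> ?D" if p: "p \<in> ?D" for c p
    proof -
      obtain x where "x \<in> E" "p = (x, J x)" using p by auto
      then show ?thesis using E(1) by (intro image_eqI[of _ _ "c *\<^sub>R x"]) (auto simp: JD subspace_scale)
    qed
  qed
  then show "subspace ?\<Gamma>'"
    using \<Gamma> by (intro subspace_sums) (auto simp: admissible_def)
  show "(z, z) \<in> ?\<Gamma>'" if "z \<in> Z" for z
  proof -
    have "(z, z) \<in> \<Gamma>" "0 \<in> ?D"
      using \<Gamma> that subspace_0[OF \<open>subspace ?D\<close>] by (auto simp: admissible_def)
    then show ?thesis by (metis (mono_tags, lifting) add.right_neutral mem_Collect_eq)
  qed
  fix r assume "r \<in> ?\<Gamma>'"
  then obtain p x where r: "r = p + (x, J x)" "p \<in> \<Gamma>" "x \<in> E" by blast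
  show "map_prod g g r \<in> ?\<Gamma>'" if g: "g \<in> \<G>" for g
  proof -
    have "map_prod g g r = map_prod g g p + (g x, J (g x))"
      using r g by (cases p) (simp add: JD linear_add[OF linear_mem])
    moreover have "map_prod g g p \<in> \<Gamma>" "g x \<in> E"
      using \<Gamma> E(2) r g by (auto simp: admissible_def invariant_def)
    ultimately show ?thesis by blast
  qed
  fix r' assume "r' \<in> ?\<Gamma>'"
  then obtain q y where r': "r' = q + (y, J y)" "q \<in> \<Gamma>" "y \<in> E" by blast
  have "inner (fst p) (fst q) = inner (snd p) (snd q)"
    using \<Gamma> r r' by (simp add: admissible_def)
  then show "inner (fst r) (fst r') = inner (snd r) (snd r')"
    using orth[OF r(3) r'(2)] orth[OF r'(3) r(2)] iso[OF r(3) r'(3)] r(1) r'(1)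
    by (simp add: inner_add_left inner_add_right inner_commute)
qed

text \<open>Otherwise \<open>J\<close>, rescaled on its top eigenspace, would be an isometric
  intertwiner between the complements of domain and range. Adjoining its graph would put nonzero
  vectors of \<open>E\<close> into the domain, to which \<open>E\<close> is orthogonal.\<close>

lemma maximal_admissible_no_intertwiner:
  assumes max: "maximal_admissible Z \<Gamma>"
    and E: "subspace E" "invariant E" "compact (E \<inter> cball 0 1)"
    and J: "intertwiner_on E J" "\<And>x. x \<in> E \<Longrightarrow> norm (J x) \<le> norm x"
    and orth: "\<And>x p. x \<in> E \<Longrightarrow> p \<in> \<Gamma> \<Longrightarrow> inner x (fst p) = 0 \<and> inner (J x) (snd p) = 0"
    and e: "e \<in> E"
  shows "J e = 0"
proof (rule ccontr)
  assume "J e \<noteq> 0"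
  then obtain c E' where c: "0 < c" "E' \<subseteq> E" "subspace E'" "invariant E'" "E' \<noteq> {0}"
    "\<And>x y. x \<in> E' \<Longrightarrow> y \<in> E' \<Longrightarrow> inner (J x) (J y) = c * inner x y"
    using intertwiner_top_eigenspace[OF E J e] by metis
  obtain x where x: "x \<in> E'" "x \<noteq> 0" using c(3,5) subspace_0 by blast
  define J' where "J' = (\<lambda>x. (1 / sqrt c) *\<^sub>R J x)"
  have adm: "admissible Z \<Gamma>" using max by (simp add: maximal_admissible_def)
  have "intertwiner_on E' J'"
    using J(1) c(2) by (auto simp: intertwiner_on_def J'_def scaleR_add_right linear_scale[OF linear_mem] subset_iff)
  moreover have "inner (J' x) (J' y) = inner x y" if "x \<in> E'" "y \<in> E'" for x y
    using c(6)[OF that] c(1) by (simp add: J'_def divide_simps)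
  moreover have "inner x (fst p) = 0 \<and> inner (J' x) (snd p) = 0" if "x \<in> E'" "p \<in> \<Gamma>" for x p
    using orth[of x p] that c(2) by (auto simp: J'_def)
  ultimately have adm': "admissible Z {p + q |p q. p \<in> \<Gamma> \<and> q \<in> (\<lambda>x. (x, J' x)) ` E'}"
    by (rule admissible_extend[OF adm c(3,4)])
  have sub: "subspace \<Gamma>" using adm by (simp add: admissible_def)
  have "0 \<in> (\<lambda>x. (x, J' x)) ` E'"
    using subspace_0[OF c(3)] subspace_0[OF E(1)] intertwiner_on_zero[OF E(1) J(1)]
    by (intro image_eqI[of _ _ 0]) (auto simp: J'_def zero_prod_def)
  then have "\<Gamma> \<subseteq> {p + q |p q. p \<in> \<Gamma> \<and> q \<in> (\<lambda>x. (x, J' x)) ` E'}"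
    by (metis (mono_tags, lifting) add.right_neutral mem_Collect_eq subsetI)
  then have "{p + q |p q. p \<in> \<Gamma> \<and> q \<in> (\<lambda>x. (x, J' x)) ` E'} = \<Gamma>"
    using max adm' by (simp add: maximal_admissible_def)
  moreover have "0 + (x, J' x) \<in> {p + q |p q. p \<in> \<Gamma> \<and> q \<in> (\<lambda>x. (x, J' x)) ` E'}"
    using x(1) subspace_0[OF sub] by blast
  ultimately have "(x, J' x) \<in> \<Gamma>" by simp
  then have "inner x x = 0" using orth[of x "(x, J' x)"] x(1) c(2) by auto
  then show False using x(2) by simp
qed

text \<open>The component of \<open>R\<close> orthogonal to the range is a contractive intertwiner
  from the complement of the domain to that of the range, and therefore zero.\<close>

lemma maximal_admissible_copies_in_range:
  assumes max: "maximal_admissible Z \<Gamma>"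
    and E: "subspace E" "invariant E" "compact (E \<inter> cball 0 1)"
    and orth: "\<And>x s. x \<in> E \<Longrightarrow> s \<in> fst ` \<Gamma> \<Longrightarrow> inner x s = 0"
    and R: "intertwiner_on E R" "\<And>x. x \<in> E \<Longrightarrow> norm (R x) = norm x"
    and e: "e \<in> E"
  shows "R e \<in> snd ` \<Gamma>"
proof -
  have adm: "admissible Z \<Gamma>" using max by (simp add: maximal_admissible_def)
  have swap: "snd ` \<Gamma> = fst ` prod.swap ` \<Gamma>" by (simp add: image_image)
  obtain P where P: "\<And>x. P x \<in> snd ` \<Gamma>" "\<And>x s. s \<in> snd ` \<Gamma> \<Longrightarrow> inner (x - P x) s = 0"
    "intertwiner_on UNIV P"
    unfolding swap
    using invariant_projection_exists admissible_domain(1,2)[OF admissible_swap[OF adm]]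
      maximal_admissible_closed_domain[OF maximal_admissible_swap[OF max]] by metis
  have "R e - P (R e) = 0"
  proof (rule maximal_admissible_no_intertwiner[OF max E, where J = "\<lambda>x. R x - P (R x)"])
    show "intertwiner_on E (\<lambda>x. R x - P (R x))"
      using R(1) P(3) by (auto simp: intertwiner_on_def linear_diff[OF linear_mem] scaleR_diff_right)
    show "norm (R x - P (R x)) \<le> norm x" if "x \<in> E" for x
    proof -
      have "orthogonal (R x - P (R x)) (P (R x))"
        using P(1,2) by (simp add: orthogonal_def)
      then have "(norm (R x - P (R x)))\<^sup>2 \<le> (norm (R x))\<^sup>2"
        using norm_add_Pythagorean[of "R x - P (R x)" "P (R x)"] by simp
      then show ?thesis
        using R(2)[OF that] by (metis norm_ge_zero power2_le_imp_le)
    qed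
    show "inner x (fst p) = 0 \<and> inner (R x - P (R x)) (snd p) = 0" if "x \<in> E" "p \<in> \<Gamma>" for x p
      using orth[OF that(1)] P(2) that(2) by simp
  qed fact
  then show ?thesis using P(1)[of "R e"] by simp
qed

text \<open>Fixing this set pointwise confines the extension problem to a space generated by two
  vectors. A maximal extension without this restraint might be a one-sided shift or its
  inverse.\<close>

definition fixed_complement :: "'a \<Rightarrow> 'a \<Rightarrow> 'a set" where
  "fixed_complement x y = {z. \<forall>g\<in>\<G>. inner z (g x) = 0 \<and> inner z (g y) = 0}"

text \<open>If the domain were proper, its complement would contain a finite-dimensional \<open>E\<close>. All copies
  of \<open>E\<close> lie in the range, so pulling \<open>E\<close> back repeatedly yields infinitely many mutually
  orthogonal copies of \<open>E\<close>, which is too many for a space generated by two vectors.\<close>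

lemma maximal_admissible_domain_UNIV:
  assumes max: "maximal_admissible (fixed_complement \<psi> \<phi>) \<Gamma>"
  shows "fst ` \<Gamma> = UNIV"
proof (rule ccontr)
  let ?Z = "fixed_complement \<psi> \<phi>" and ?K = "fst ` \<Gamma>" and ?L = "snd ` \<Gamma>"
  assume "?K \<noteq> UNIV"
  then obtain x where x: "x \<notin> ?K" by blast
  have adm: "admissible ?Z \<Gamma>" using max by (simp add: maximal_admissible_def)
  note K = admissible_domain[OF adm] maximal_admissible_closed_domain[OF max]
  define M where "M = {x. \<forall>s\<in>?K. inner x s = 0}"
  obtain p where p: "p \<in> ?K" "\<And>s. s \<in> ?K \<Longrightarrow> inner (x - p) s = 0"
    using orthogonal_projection_exists[OF K(1,4)] by metis
  then have "x - p \<in> M" "x - p \<noteq> 0" using x by (auto simp: M_def)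
  moreover have "subspace M" by (auto simp: subspace_def M_def inner_add_left)
  moreover have "invariant M" unfolding M_def by (rule invariant_orthogonal[OF K(2)])
  moreover have "closed M"
  proof -
    have "M = (\<Inter>s\<in>?K. {x. inner x s = 0})" by (auto simp: M_def)
    then show ?thesis
      by (auto intro!: closed_INT closed_Collect_eq continuous_intros)
  qed
  ultimately obtain E B where E: "E \<subseteq> M" "subspace E" "invariant E" "E \<noteq> {0}" and B: "finite B" "E \<subseteq> span B"
    and cpt: "compact (E \<inter> cball 0 1)"
    using exists_finite_dim_invariant_subspace by metis
  have E_orth: "inner x s = 0" if "x \<in> E" "s \<in> ?K" for x s
    using that E(1) by (auto simp: M_def)
  obtain C where C: "C \<subseteq> E" "independent C" "E \<subseteq> span C"
    by (rule maximal_independent_subset)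
  then have finC: "finite C" using independent_span_bound[OF B(1) C(2)] B(2) by blast

  have "\<forall>y. y \<in> ?L \<longrightarrow> (\<exists>x. (x, y) \<in> \<Gamma>)" by force
  \<comment> \<open>The inverse of the partial isometry on \<open>?L\<close>. Off \<open>?L\<close>
    its values are arbitrary, so each iterate must be shown to land in \<open>?L\<close> before
    \<open>W\<close> is applied again.\<close>
  then obtain W where W: "\<And>y. y \<in> ?L \<Longrightarrow> (W y, y) \<in> \<Gamma>" by metis
  have W_eq: "W y = x" if "(x, y) \<in> \<Gamma>" for x y
    by (rule admissible_unique[OF adm W that]) (use that in force)
  have sub: "subspace \<Gamma>" using adm by (simp add: admissible_def)
  have W_inner: "inner (W y) (W y') = inner y y'" if "y \<in> ?L" "y' \<in> ?L" for y y'
    using adm W[OF that(1)] W[OF that(2)] unfolding admissible_def by fastforce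
  define R where "R n = (W ^^ n)" for n :: nat
  have R_Suc: "R (Suc n) x = W (R n x)" for n x by (simp add: R_def)
  \<comment> \<open>Isometry puts the values of \<open>R n\<close> into \<open>?L\<close>.
    Orthogonality to \<open>?Z\<close> survives pulling back because \<open>\<Gamma>\<close> fixes
    \<open>?Z\<close> pointwise; it is used for the final contradiction.\<close>
  have R: "intertwiner_on E (R n) \<and> (\<forall>x\<in>E. \<forall>y\<in>E. inner (R n x) (R n y) = inner x y) \<and>
      (\<forall>x\<in>E. \<forall>z\<in>?Z. inner (R n x) z = 0)" for n
  proof (induction n)
    case 0
    then show ?case
      using E_orth subsetD[OF K(3)] by (simp add: R_def intertwiner_on_def)
  next
    case (Suc n)
    have RL: "R n x \<in> ?L" if "x \<in> E" for x
    proof (rule maximal_admissible_copies_in_range[OF max E(2,3) cpt E_orth _ _ that])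
      show "norm (R n x) = norm x" if "x \<in> E" for x
        using Suc that by (simp add: norm_eq_sqrt_inner)
    qed (use Suc in auto)
    have "intertwiner_on E (R (Suc n))"
      unfolding intertwiner_on_def
    proof (intro conjI ballI allI)
      note RD = intertwiner_onD[OF Suc[THEN conjunct1]]
      fix x assume x: "x \<in> E"
      show "R (Suc n) (x + y) = R (Suc n) x + R (Suc n) y" if y: "y \<in> E" for y
        unfolding R_Suc RD(1)[OF x y]
        by (rule W_eq) (use subspace_add[OF sub W[OF RL[OF x]] W[OF RL[OF y]]] in simp)
      show "R (Suc n) (c *\<^sub>R x) = c *\<^sub>R R (Suc n) x" for c
        unfolding R_Suc RD(2)[OF x]
        by (rule W_eq) (use subspace_scale[OF sub W[OF RL[OF x]]] in simp)
      show "R (Suc n) (g x) = g (R (Suc n) x)" if g: "g \<in> \<G>" for g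
        unfolding R_Suc RD(3)[OF x g]
        by (rule W_eq) (use adm W[OF RL[OF x]] g in \<open>fastforce simp: admissible_def\<close>)
    qed
    moreover have "inner (R (Suc n) x) (R (Suc n) y) = inner x y" if "x \<in> E" "y \<in> E" for x y
      using W_inner RL that Suc by (simp add: R_Suc)
    moreover have "inner (R (Suc n) x) z = 0" if x: "x \<in> E" and z: "z \<in> ?Z" for x z
    proof -
      have "inner (W (R n x)) z = inner (R n x) z"
        using adm W[OF RL[OF x]] z unfolding admissible_def by fastforce
      then show ?thesis using Suc x z by (simp add: R_Suc)
    qed
    ultimately show ?case by blast
  qed
  have RL: "R n x \<in> ?L" if "x \<in> E" for x n
  proof (rule maximal_admissible_copies_in_range[OF max E(2,3) cpt E_orth _ _ that])
    show "norm (R n x) = norm x" if "x \<in> E" for x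
      using R that by (simp add: norm_eq_sqrt_inner)
  qed (use R in auto)
  \<comment> \<open>A pulled-back vector lies in the domain, to which \<open>E\<close> is
    orthogonal; applying the isometry \<open>W\<close> to both sides raises both indices.\<close>
  have R_orth: "inner (R m x) (R (m + Suc k) y) = 0" if "x \<in> E" "y \<in> E" for m k x y
  proof (induction m)
    case 0
    have "R (Suc k) y \<in> ?K"
      unfolding R_Suc using W[OF RL[OF that(2)]] by force
    then show ?case using E_orth that(1) by (simp add: R_def)
  next
    case (Suc m)
    then show ?case
      unfolding add_Suc R_Suc W_inner[OF RL[OF that(1)] RL[OF that(2)]] .
  qed
  have R_orth': "inner (R m x) (R n y) = (if m = n then inner x y else 0)" if "x \<in> E" "y \<in> E" for m n x y
  proof (cases m n rule: linorder_cases)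
    case less
    then show ?thesis using R_orth[OF that, of m "n - Suc m"] by simp
  next
    case equal
    then show ?thesis using R that by simp
  next
    case greater
    then show ?thesis using R_orth[OF that(2,1), of n "m - Suc n"] by (simp add: inner_commute)
  qed

  \<comment> \<open>The combination \<open>s\<close> of the copies, with coefficients
    \<open>a\<close>, is to have values orthogonal to \<open>\<psi>\<close> and
    \<open>\<phi>\<close>. On the finite spanning set \<open>C\<close> of \<open>E\<close> these are
    finitely many conditions on \<open>a\<close>.\<close>
  let ?F = "(\<lambda>b n. inner (R n b) \<psi>) ` C \<union> (\<lambda>b n. inner (R n b) \<phi>) ` C"
  have "finite ?F" using finC by simp
  from finitely_supported_annihilator[OF this, of 0]
  obtain a m where a: "\<exists>n. a n \<noteq> 0" "\<And>n. m \<le> n \<Longrightarrow> a n = 0"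
    "\<forall>f\<in>?F. (\<Sum>n<m. a n * f n) = 0"
    by auto
  obtain k where k: "a k \<noteq> 0" using a(1) by blast
  then have "k < m" using a(2) by (meson not_le)
  define s where "s x = (\<Sum>n<m. a n *\<^sub>R R n x)" for x
  have RD: "intertwiner_on E (R n)" for n using R by blast
  have "s 0 = 0" by (simp add: s_def intertwiner_on_zero[OF E(2) RD])
  moreover have "s (x + y) = s x + s y" if "x \<in> E" "y \<in> E" for x y
    using that by (simp add: s_def intertwiner_onD[OF RD] scaleR_add_right sum.distrib)
  moreover have "s (c *\<^sub>R x) = c *\<^sub>R s x" if "x \<in> E" for c x
    using that by (simp add: s_def intertwiner_onD[OF RD] scaleR_sum_right mult.commute)
  ultimately have "subspace {x \<in> E. inner (s x) v = 0}" for v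
    unfolding subspace_def using E(2)
    by (simp add: subspace_0 subspace_add subspace_scale inner_add_left)
  moreover have "C \<subseteq> {x \<in> E. inner (s x) v = 0}" if "v \<in> {\<psi>, \<phi>}" for v
    using a(3) C(1) that by (auto simp: s_def inner_sum_left)
  ultimately have s_orth: "inner (s x) v = 0" if "x \<in> E" "v \<in> {\<psi>, \<phi>}" for x v
    using span_minimal[of C "{x \<in> E. inner (s x) v = 0}"] C(3) that by blast
  \<comment> \<open>Equivariance of \<open>s\<close> and invariance of \<open>E\<close> spread
    orthogonality from the two vectors to their orbits. Thus \<open>s x\<close> lies in
    \<open>?Z\<close> and is also orthogonal to it.\<close>
  have "s x \<in> ?Z" if x: "x \<in> E" for x
  proof -
    have "inner (s x) (g v) = 0" if g: "g \<in> \<G>" and v: "v \<in> {\<psi>, \<phi>}" for g v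
    proof -
      obtain h where h: "h \<in> \<G>" "\<And>x y. inner (h x) y = inner x (g y)"
        by (rule inner_mem_left[OF g]) blast
      have "h (s x) = s (h x)"
        using x h(1) by (simp add: s_def linear_sum[OF linear_mem] linear_scale[OF linear_mem] intertwiner_onD[OF RD])
      moreover have "h x \<in> E" using E(3) x h(1) by (simp add: invariant_def)
      ultimately show ?thesis using s_orth[of "h x" v] v by (simp add: h(2)[symmetric])
    qed
    then show ?thesis by (simp add: fixed_complement_def)
  qed
  moreover have "inner (s x) z = 0" if "x \<in> E" "z \<in> ?Z" for x z
    using R that by (simp add: s_def inner_sum_left)
  ultimately have s0: "s x = 0" if "x \<in> E" for x
    using that by (metis inner_eq_zero_iff)
  obtain e where e: "e \<in> E" "e \<noteq> 0" using E(2,4) subspace_0 by blast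
  \<comment> \<open>Pairing with the copy of index \<open>k\<close> isolates the nonzero coefficient
    \<open>a k\<close>.\<close>
  have "inner (s e) (R k e) = (\<Sum>n<m. if n = k then a k * inner e e else 0)"
    by (simp add: s_def inner_sum_left R_orth'[OF e(1) e(1)] if_distrib cong: if_cong)
  also have "\<dots> = a k * inner e e" using \<open>k < m\<close> by simp
  finally show False using s0[OF e(1)] k e(2) by simp
qed

theorem exists_orthogonal_intertwiner:
  assumes eq: "\<And>g. g \<in> \<G> \<Longrightarrow> inner \<psi> (g \<psi>) = inner \<phi> (g \<phi>)"
  shows "\<exists>V. linear V \<and> bij V \<and> (\<forall>x y. inner (V x) (V y) = inner x y) \<and>
    (\<forall>g\<in>\<G>. \<forall>x. V (g x) = g (V x)) \<and> V \<psi> = \<phi>"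
proof -
  let ?Z = "fixed_complement \<psi> \<phi>"
  \<comment> \<open>Generators of the initial graph. Its isometry on the orbits is the hypothesis,
    applied to the inverse of one group element composed with another; orbits and \<open>?Z\<close>
    are orthogonal on both sides.\<close>
  define S where "S = (\<lambda>g. (g \<psi>, g \<phi>)) ` \<G> \<union> (\<lambda>z. (z, z)) ` ?Z"
  have S_inner: "inner (fst p) (fst q) = inner (snd p) (snd q)" if "p \<in> S" "q \<in> S" for p q
  proof -
    have "inner (g \<psi>) (h \<psi>) = inner (g \<phi>) (h \<phi>)" if g: "g \<in> \<G>" and h: "h \<in> \<G>" for g h
    proof -
      obtain k where k: "k \<in> \<G>" "\<And>x y. inner (g x) y = inner x (k y)"
        by (rule inner_mem_left[OF g]) blast
      show ?thesis
        unfolding k(2) using eq[OF comp_mem[OF k(1) h]] by simp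
    qed
    then show ?thesis
      using that by (auto simp: S_def fixed_complement_def inner_commute)
  qed
  have S_inv: "map_prod g g ` span S \<subseteq> span S" if g: "g \<in> \<G>" for g
  proof -
    have "linear (map_prod g g)"
      by (rule linearI) (auto simp: linear_add[OF linear_mem] linear_scale[OF linear_mem] g)
    moreover have "map_prod g g ` S \<subseteq> S"
    proof -
      have "invariant {z. \<forall>s\<in>orbit \<psi> \<union> orbit \<phi>. inner z s = 0}"
      proof (rule invariant_orthogonal)
        have "h (k x) \<in> orbit x" if "h \<in> \<G>" "k \<in> \<G>" for h k x
          unfolding orbit_def using comp_mem[OF that] by (intro image_eqI[of _ _ "h \<circ> k"]) auto
        then show "invariant (orbit \<psi> \<union> orbit \<phi>)" by (auto simp: invariant_def orbit_def)
      qed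
      moreover have "{z. \<forall>s\<in>orbit \<psi> \<union> orbit \<phi>. inner z s = 0} = ?Z"
        by (auto simp: orbit_def fixed_complement_def)
      ultimately have "g z \<in> ?Z" if "z \<in> ?Z" for z
        using that g by (simp add: invariant_def)
      moreover have "(g (h \<psi>), g (h \<phi>)) \<in> S" if "h \<in> \<G>" for h
        unfolding S_def using comp_mem[OF g that] by (intro UnI1 image_eqI[of _ _ "g \<circ> h"]) auto
      ultimately show ?thesis by (auto simp: S_def)
    qed
    ultimately show ?thesis
      by (metis linear_span_image span_mono)
  qed
  have adm0: "admissible ?Z (span S)"
    unfolding admissible_def
  proof (intro conjI ballI)
    show "subspace (span S)" by (rule subspace_span)
    show "map_prod g g p \<in> span S" if "g \<in> \<G>" "p \<in> span S" for g p
      using S_inv that by blast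
    show "inner (fst p) (fst q) = inner (snd p) (snd q)" if "p \<in> span S" "q \<in> span S" for p q
      using S_inner that by (rule inner_eq_span)
    show "(z, z) \<in> span S" if "z \<in> ?Z" for z
      by (rule span_base) (use that in \<open>auto simp: S_def\<close>)
  qed
  let ?A = "{\<Gamma>. admissible ?Z \<Gamma> \<and> span S \<subseteq> \<Gamma>}"
  have "\<exists>\<Gamma>\<in>?A. \<forall>X\<in>?A. \<Gamma> \<subseteq> X \<longrightarrow> X = \<Gamma>"
  proof (rule subset_Zorn_nonempty)
    show "?A \<noteq> {}" using adm0 by blast
    fix \<C> assume ne: "\<C> \<noteq> {}" and ch: "subset.chain ?A \<C>"
    have adm: "admissible ?Z X" if "X \<in> \<C>" for X
      using ch that by (auto simp: subset_chain_def)
    have common: "\<exists>X\<in>\<C>. p \<in> X \<and> q \<in> X" if "p \<in> \<Union>\<C>" "q \<in> \<Union>\<C>" for p q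
      using ch that unfolding subset_chain_def by blast
    have "admissible ?Z (\<Union>\<C>)"
      unfolding admissible_def
    proof (intro conjI ballI)
      show "subspace (\<Union>\<C>)"
      proof (rule subspaceI)
        show "0 \<in> \<Union>\<C>" using ne adm by (auto simp: admissible_def subspace_0)
        show "p + q \<in> \<Union>\<C>" if "p \<in> \<Union>\<C>" "q \<in> \<Union>\<C>" for p q
          using common[OF that] adm by (auto simp: admissible_def intro: subspace_add)
        show "c *\<^sub>R p \<in> \<Union>\<C>" if "p \<in> \<Union>\<C>" for c p
          using that adm by (auto simp: admissible_def intro: subspace_scale)
      qed
      show "map_prod g g p \<in> \<Union>\<C>" if "g \<in> \<G>" "p \<in> \<Union>\<C>" for g p
        using that adm unfolding admissible_def by blast
      show "inner (fst p) (fst q) = inner (snd p) (snd q)" if "p \<in> \<Union>\<C>" "q \<in> \<Union>\<C>" for p q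
        using common[OF that] adm unfolding admissible_def by blast
      show "(z, z) \<in> \<Union>\<C>" if "z \<in> ?Z" for z
        using that ne adm unfolding admissible_def by blast
    qed
    moreover have "span S \<subseteq> \<Union>\<C>"
    proof -
      obtain X where "X \<in> \<C>" using ne by blast
      moreover from this have "span S \<subseteq> X" using ch by (auto simp: subset_chain_def)
      ultimately show ?thesis by blast
    qed
    ultimately show "\<Union>\<C> \<in> ?A" by simp
  qed
  then obtain \<Gamma> where \<Gamma>: "admissible ?Z \<Gamma>" "span S \<subseteq> \<Gamma>"
    and upper: "\<forall>X\<in>?A. \<Gamma> \<subseteq> X \<longrightarrow> X = \<Gamma>"
    by blast
  have max: "maximal_admissible ?Z \<Gamma>"
    unfolding maximal_admissible_def
  proof (intro conjI allI impI)
    fix X assume "admissible ?Z X" "\<Gamma> \<subseteq> X"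
    then show "X = \<Gamma>" using \<Gamma>(2) upper by simp
  qed (rule \<Gamma>(1))
  have dom: "fst ` \<Gamma> = UNIV" by (rule maximal_admissible_domain_UNIV[OF max])
  \<comment> \<open>The inverse graph is maximal for the same fixed complement, so its domain is the
    whole space as well.\<close>
  have ran: "snd ` \<Gamma> = UNIV"
    using maximal_admissible_domain_UNIV[OF maximal_admissible_swap[OF max]] by (simp add: image_image)
  have "\<forall>x. \<exists>y. (x, y) \<in> \<Gamma>" using dom by (metis UNIV_I imageE prod.collapse)
  then obtain V where V: "\<And>x. (x, V x) \<in> \<Gamma>" by metis
  \<comment> \<open>Single-valuedness of \<open>\<Gamma>\<close> is injectivity of its
    inverse.\<close>
  have V_eq: "V x = y" if "(x, y) \<in> \<Gamma>" for x y
  proof (rule admissible_unique[OF admissible_swap[OF \<Gamma>(1)]])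
    show "(V x, x) \<in> prod.swap ` \<Gamma>" "(y, x) \<in> prod.swap ` \<Gamma>"
      using V that by force+
  qed
  have sub: "subspace \<Gamma>" using \<Gamma>(1) by (simp add: admissible_def)
  show ?thesis
  proof (intro exI conjI allI ballI)
    show "linear V"
    proof (rule linearI)
      show "V (x + y) = V x + V y" for x y
        using subspace_add[OF sub V V, of x y] by (intro V_eq) simp
      show "V (c *\<^sub>R x) = c *\<^sub>R V x" for c x
        using subspace_scale[OF sub V, of c x] by (intro V_eq) simp
    qed
    show "inner (V x) (V y) = inner x y" for x y
      using \<Gamma>(1) V[of x] V[of y] unfolding admissible_def by fastforce
    show "V (g x) = g (V x)" if "g \<in> \<G>" for g x
      using \<Gamma>(1) V[of x] that by (intro V_eq) (fastforce simp: admissible_def)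
    show "bij V"
    proof (rule bijI)
      show "inj V"
        using V by (intro injI) (metis admissible_unique[OF \<Gamma>(1)])
      show "surj V"
      proof (rule surjI)
        fix y
        have "y \<in> snd ` \<Gamma>" using ran by simp
        then have "\<exists>x. (x, y) \<in> \<Gamma>" by force
        then show "V (SOME x. (x, y) \<in> \<Gamma>) = y" by (rule V_eq[OF someI_ex])
      qed
    qed
    have "(\<psi>, \<phi>) \<in> S"
      using id_mem by (auto simp: S_def intro: image_eqI[of _ _ id])
    then show "V \<psi> = \<phi>"
      using \<Gamma>(2) span_base[of _ S] by (auto intro!: V_eq)
  qed
qed

end

section \<open>Complex Hilbert spaces and unitary representations\<close>

lemma scaleC_eq: "a *\<^sub>C x = Re a *\<^sub>R x + Im a *\<^sub>R (\<i> *\<^sub>C x)"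
  for x :: "'h::complex_hilbert_space"
proof -
  have "a *\<^sub>C x = (complex_of_real (Re a) + complex_of_real (Im a) * \<i>) *\<^sub>C x"
    by (simp add: complex_eq[of a, symmetric] mult.commute)
  then show ?thesis by (simp add: scaleC_add_left scaleC_of_real flip: scaleC_scaleC)
qed

lemma scaleC_scaleR: "a *\<^sub>C (r *\<^sub>R x) = r *\<^sub>R (a *\<^sub>C x)" for x :: "'h::complex_hilbert_space"
  by (simp add: scaleC_scaleC mult.commute flip: scaleC_of_real)

lemma scaleC_one: "1 *\<^sub>C x = x" for x :: "'h::complex_hilbert_space"
  using scaleC_of_real[of 1 x] by simp

lemma cinner_scaleC_left: "cinner (a *\<^sub>C x) y = cnj a * cinner x y"
  by (subst (1 2) cinner_commute) (simp add: cinner_scaleC_right)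

lemma cinner_eq_inner: "cinner x y = Complex (inner x y) (- inner x (\<i> *\<^sub>C y))"
  using Re_cinner[of x y] Re_cinner[of x "\<i> *\<^sub>C y"]
  by (simp add: complex_eq_iff cinner_scaleC_right)

lemma inner_scaleC_unit:
  assumes "cmod a = 1"
  shows "inner (a *\<^sub>C x) (a *\<^sub>C y) = inner x y"
proof -
  have "cinner (a *\<^sub>C x) (a *\<^sub>C y) = (a * cnj a) * cinner x y"
    by (simp add: cinner_scaleC_left cinner_scaleC_right)
  also have "a * cnj a = 1"
    using assms complex_norm_square[of a] by simp
  finally show ?thesis by (simp flip: Re_cinner)
qed

lemma linear_scaleC: "linear (\<lambda>x::'h::complex_hilbert_space. a *\<^sub>C x)"
  by (rule linearI) (simp_all add: scaleC_add_right scaleC_scaleR)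

section \<open>Unitary operators as real orthogonal maps\<close>

lemma unitary_opD:
  assumes "unitary_op V"
  shows "V (x + y) = V x + V y" "V (a *\<^sub>C x) = a *\<^sub>C V x" "bij V" "cinner (V x) (V y) = cinner x y"
  using assms by (auto simp: unitary_op_def)

lemma linear_unitary_op:
  assumes "unitary_op V"
  shows "linear V"
  using unitary_opD(1)[OF assms] unitary_opD(2)[OF assms, of "of_real _"]
  by (intro linearI) (simp_all add: scaleC_of_real)

text \<open>The imaginary part of \<open>cinner x y\<close> is minus the real inner product of
  \<open>x\<close> with \<open>\<i> *\<^sub>C y\<close>, so commuting with \<open>\<i>\<close>
  suffices to recover the complex structure from the real one.\<close>

lemma unitary_op_iff_linear:
  "unitary_op V \<longleftrightarrow> linear V \<and> bij V \<and> (\<forall>x y. inner (V x) (V y) = inner x y) \<and>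
    (\<forall>x. V (\<i> *\<^sub>C x) = \<i> *\<^sub>C V x)" (is "_ \<longleftrightarrow> ?R")
proof
  assume "unitary_op V"
  then show ?R
    by (simp add: linear_unitary_op unitary_opD flip: Re_cinner)
next
  assume V: ?R
  have "V (a *\<^sub>C x) = a *\<^sub>C V x" for a x
    using V by (subst (1 2) scaleC_eq) (simp add: linear_add linear_scale)
  moreover have "cinner (V x) (V y) = cinner x y" for x y
    unfolding cinner_eq_inner using V by (metis (no_types))
  ultimately show "unitary_op V"
    using V by (auto simp: unitary_op_def linear_add)
qed

definition circle_extension ::
    "('g, 'm) monoid_scheme \<Rightarrow> ('g \<Rightarrow> 'h::complex_hilbert_space \<Rightarrow> 'h) \<Rightarrow> ('h \<Rightarrow> 'h) set" where
  "circle_extension G U = {\<lambda>x. a *\<^sub>C U g x |a g. cmod a = 1 \<and> g \<in> carrier G}"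

text \<open>Adjoining the unit scalars makes commuting real-linear maps complex-linear, so that only real
  Hilbert spaces need to be considered.\<close>

lemma orthogonal_group_circle_extension:
  fixes U :: "'g \<Rightarrow> 'h::complex_hilbert_space \<Rightarrow> 'h"
  assumes G: "group G" and T: "compact_space T" "topspace T = carrier G"
    and U: "unitary_representation G T U"
  shows "orthogonal_group (circle_extension G U)" and "U \<one>\<^bsub>G\<^esub> = id"
proof -
  interpret group G by (rule G)
  have unit: "unitary_op (U g)" if "g \<in> carrier G" for g
    using U that by (simp add: unitary_representation_def)
  have mult: "U (g \<otimes>\<^bsub>G\<^esub> h) x = U g (U h x)" if "g \<in> carrier G" "h \<in> carrier G" for g h x
    using U that by (simp add: unitary_representation_def)
  have one: "U \<one>\<^bsub>G\<^esub> x = x" for x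
  proof -
    \<comment> \<open>The operator of the unit is idempotent; being injective, it is the
      identity.\<close>
    have "U \<one>\<^bsub>G\<^esub> (U \<one>\<^bsub>G\<^esub> x) = U \<one>\<^bsub>G\<^esub> x"
      using mult[of "\<one>\<^bsub>G\<^esub>" "\<one>\<^bsub>G\<^esub>" x] by simp
    then show ?thesis
      using unitary_opD(3)[OF unit[OF one_closed]] by (meson bij_def injD)
  qed
  then show "U \<one>\<^bsub>G\<^esub> = id" by auto
  have memI: "f \<in> circle_extension G U" if "cmod a = 1" "g \<in> carrier G" "\<And>x. f x = a *\<^sub>C U g x" for f a g
    unfolding circle_extension_def using that by blast
  show "orthogonal_group (circle_extension G U)"
  proof (rule orthogonal_group.intro)
    show "id \<in> circle_extension G U"
      by (rule memI[of 1 "\<one>\<^bsub>G\<^esub>"]) (simp_all add: one scaleC_one)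
    fix f assume "f \<in> circle_extension G U"
    then obtain a g where f: "f = (\<lambda>x. a *\<^sub>C U g x)" "cmod a = 1" "g \<in> carrier G"
      unfolding circle_extension_def by blast
    note D = unitary_opD[OF unit]
    show "f \<circ> f' \<in> circle_extension G U" if f': "f' \<in> circle_extension G U" for f'
    proof -
      obtain b h where h: "f' = (\<lambda>x. b *\<^sub>C U h x)" "cmod b = 1" "h \<in> carrier G"
        using f' unfolding circle_extension_def by blast
      show ?thesis
        by (rule memI[of "a * b" "g \<otimes>\<^bsub>G\<^esub> h"])
          (use f h in \<open>simp_all add: norm_mult mult D scaleC_scaleC\<close>)
    qed
    show "\<exists>h\<in>circle_extension G U. (\<forall>x. h (f x) = x) \<and> (\<forall>x. f (h x) = x)"
    proof (intro bexI conjI allI)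
      let ?h = "\<lambda>x. cnj a *\<^sub>C U (inv\<^bsub>G\<^esub> g) x"
      have "cnj a * a = 1" "a * cnj a = 1"
        using f(2) complex_norm_square[of a] by (simp_all add: mult.commute)
      then show "?h (f x) = x" "f (?h x) = x" for x
        using f(3) mult[of "inv\<^bsub>G\<^esub> g" g x] mult[of g "inv\<^bsub>G\<^esub> g" x]
        by (simp_all add: f(1) D scaleC_scaleC one scaleC_one)
      show "?h \<in> circle_extension G U"
        by (rule memI[of "cnj a" "inv\<^bsub>G\<^esub> g"]) (use f in simp_all)
    qed
    show "linear f"
      unfolding f(1) using linear_compose[OF linear_unitary_op[OF unit[OF f(3)]] linear_scaleC]
      by (simp add: o_def)
    show "inner (f x) (f y) = inner x y" for x y
      unfolding f(1) inner_scaleC_unit[OF f(2)] by (simp add: D f(3) flip: Re_cinner)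
  next
    fix x
    have "compactin euclidean ((\<lambda>g. U g x) ` carrier G)"
      using U T by (intro image_compactin[of T]) (auto simp: unitary_representation_def compact_space_def)
    then have orbit: "compact ((\<lambda>g. U g x) ` carrier G)" by simp
    have "bounded_linear (\<lambda>x::'h. \<i> *\<^sub>C x)"
      by (intro bounded_linear_intro[where K = 1])
        (simp_all add: scaleC_add_right scaleC_scaleR norm_eq_sqrt_inner inner_scaleC_unit)
    \<comment> \<open>Joint continuity of complex scalar multiplication, written in real coordinates
      by \<open>scaleC_eq\<close>.\<close>
    then have "continuous_on S (\<lambda>p. Re (fst p) *\<^sub>R snd p + Im (fst p) *\<^sub>R (\<i> *\<^sub>C snd p :: 'h))" for S
      by (intro continuous_intros bounded_linear.continuous_on[of "\<lambda>x. \<i> *\<^sub>C x"])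
    \<comment> \<open>An orbit of the extended group is the continuous image of the unit circle
      times an orbit of \<open>G\<close>.\<close>
    then have "compact ((\<lambda>p. fst p *\<^sub>C snd p) ` (sphere 0 1 \<times> (\<lambda>g. U g x) ` carrier G))"
      unfolding scaleC_eq[symmetric]
      by (intro compact_continuous_image compact_Times orbit compact_sphere)
    moreover have "(\<lambda>p. fst p *\<^sub>C snd p) ` (sphere 0 1 \<times> (\<lambda>g. U g x) ` carrier G) = (\<lambda>f. f x) ` circle_extension G U"
      unfolding circle_extension_def by (force simp: image_iff)
    ultimately show "compact ((\<lambda>f. f x) ` circle_extension G U)" by simp
  qed
qed

theorem mainTheorem1:
  fixes G :: "('g, 'm) monoid_scheme"
    and T :: "'g topology"
    and A :: "('g, 'e::euclidean_space) chart set"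
    and U :: "'g \<Rightarrow> 'h::complex_hilbert_space \<Rightarrow> 'h"
    and \<psi> \<phi> :: 'h
  assumes "finite_discrete_group G T \<or> compact_lie_group G T A"
    and "unitary_representation G T U"
    and "norm \<psi> = 1" and "norm \<phi> = 1"
  shows "unitarily_equivalent G U \<psi> \<phi> \<longleftrightarrow>
    (\<forall>g\<in>carrier G. characteristic_function U \<psi> g = characteristic_function U \<phi> g)"
proof
  assume "unitarily_equivalent G U \<psi> \<phi>"
  then obtain V where V: "unitary_op V" "\<And>g. g \<in> carrier G \<Longrightarrow> V \<circ> U g = U g \<circ> V" "V \<psi> = \<phi>"
    by (auto simp: unitarily_equivalent_def)
  show "\<forall>g\<in>carrier G. characteristic_function U \<psi> g = characteristic_function U \<phi> g"
  proof
    fix g assume "g \<in> carrier G"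
    then have "U g \<phi> = V (U g \<psi>)"
      using V(2,3) by (metis comp_apply)
    then show "characteristic_function U \<psi> g = characteristic_function U \<phi> g"
      using unitary_opD(4)[OF V(1)] V(3) by (metis characteristic_function_def)
  qed
next
  assume \<chi>: "\<forall>g\<in>carrier G. characteristic_function U \<psi> g = characteristic_function U \<phi> g"
  have G: "group G" "compact_space T" "topspace T = carrier G"
    using assms(1) by (auto simp: finite_discrete_group_def compact_lie_group_def lie_group_def
        compact_space_discrete_topology)
  interpret group G by (rule G(1))
  interpret orthogonal_group "circle_extension G U"
    by (rule orthogonal_group_circle_extension[OF G assms(2)])
  \<comment> \<open>For an element \<open>a *\<^sub>C U g x\<close> of the extension, the real inner
    product is the real part of \<open>a\<close> times the characteristic function at
    \<open>g\<close>.\<close>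
  have eq: "inner \<psi> (f \<psi>) = inner \<phi> (f \<phi>)" if "f \<in> circle_extension G U" for f
    using that \<chi> by (auto simp: circle_extension_def characteristic_function_def cinner_scaleC_right
        simp flip: Re_cinner)
  obtain V where V: "linear V" "bij V" "\<And>x y. inner (V x) (V y) = inner x y"
    "\<And>f x. f \<in> circle_extension G U \<Longrightarrow> V (f x) = f (V x)" "V \<psi> = \<phi>"
    using exists_orthogonal_intertwiner[OF eq] by blast
  have V_comm: "V (a *\<^sub>C U g x) = a *\<^sub>C U g (V x)" if "cmod a = 1" "g \<in> carrier G" for a g x
    using V(4)[of "\<lambda>x. a *\<^sub>C U g x"] that by (auto simp: circle_extension_def)
  \<comment> \<open>Multiplication by \<open>\<i>\<close> is itself a member of the extension, with
    the unit of the group as second component.\<close>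
  have "V (\<i> *\<^sub>C x) = \<i> *\<^sub>C V x" for x
    using V_comm[of \<i> "\<one>\<^bsub>G\<^esub>"] orthogonal_group_circle_extension(2)[OF G assms(2)] by simp
  then have "unitary_op V"
    using V(1-3) by (simp add: unitary_op_iff_linear)
  moreover have "V \<circ> U g = U g \<circ> V" if "g \<in> carrier G" for g
    using V_comm[of 1 g] that by (auto simp: scaleC_one)
  ultimately show "unitarily_equivalent G U \<psi> \<phi>"
    using V(5) by (auto simp: unitarily_equivalent_def)
qed

end
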